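(* Consider the distributed problem of minimizing $f=\sum_{i\in V}f_i$ over $X=\bigcap_{i\in V}X_i$ and the random projected proximal algorithm described in the context. Assume: (1) each $X_i^j\subset\mathbb{R}^d$ ($i\in V$, $j\in I_i$) is closed and convex, and $X\neq\emptyset$; each $f_i:\mathbb{R}^d\to\mathbb{R}$ is convex; for each $i\in V$ there is $M_i\in\mathbb{R}$ with $\|g\|\le M_i$ for all $x\in X_i$ and all $g\in\partial f_i(x)$; and the solution set $X^\star$ is nonempty; (2) there is an integer $Q\ge 1$ such that for every $k\ge 0$ the directed graph $(V,\bigcap_{l=0}^{Q-1}E(k+l))$ is strongly connected; (3) the random variables $\Omega_i(k)$ ($i\in V$, $k\ge0$) are independent, and independent of the initial points $x_i(0)$ ($i\in V$); for each $i$ the variables $\Omega_i(k)$, $k\ge 0$, are identically distributed; and $\Pr\{\Omega_i(k)=j\}>0$ for all $i\in V$, $j\in I_i$; (4) there is $c>0$ such that $\mathrm{d}(x,X)^2\le c\,\mathrm{E}[\mathrm{d}(x,X_i^{\Omega_i(k)})^2]$ for all $i\in V$, $x\in\mathbb{R}^d$, $k\ge 0$; (5) for all $k\ge 0$: $w_{ij}(k)\ge 0$ for all $i,j\in V$, $w_{ij}(k)=0$ if $j\notin N_i(k)$, $\sum_{j\in V}w_{ij}(k)=1$ for all $i$, and $\sum_{i\in V}w_{ij}(k)=1$ for all $j$; moreover there is $w\in(0,1)$ with $w_{ij}(k)\ge w$ for all $i\in V$, $k\ge0$, $j\in N_i(k)$; and $(\alpha_k)_{k\ge0}\subset(0,\infty)$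 satisfies $\sum_{k}\alpha_k=\infty$ and $\sum_k\alpha_k^2<\infty$. Then there is a random point $x^\star\in X^\star$ such that, for every $i\in V$, the sequence $(x_i(k))_{k\ge0}$ generated by the algorithm converges almost surely to $x^\star$.
   Context: Setting. $V=\{1,\dots,m\}$ is a set of users. $I=\{1,\dots,n\}$ is the disjoint union of nonempty sets $I_i$ ($i\in V$). User $i$ has a function $f_i:\mathbb{R}^d\to\mathbb{R}$ and sets $X_i^j\subset\mathbb{R}^d$ ($j\in I_i$); $X_i:=\bigcap_{j\in I_i}X_i^j$, $X:=\bigcap_{i\in V}X_i$, $f:=\sum_{i\in V}f_i$, $f^\star:=\inf_{x\in X}f(x)$, $X^\star:=\{x\in X: f(x)=f^\star\}$. Notation. $\mathbb{R}^d$ carries the Euclidean norm. For a nonempty closed convex $C$, $P_C$ is the metric (nearest-point) projection onto $C$ and $\mathrm{d}(x,C)=\inf_{y\in C}\|x-y\|$. $\partial f_i$ is the convex subdifferential. $\mathrm{prox}_{g}(x)$ is the unique minimizer over $y\in\mathbb{R}^d$ of $g(y)+\frac12\|x-y\|^2$. Network. At each time $k\ge0$ there is a directed graph $(V,E(k))$, $E(k)\subset V\times V$, where $(i,j)\in E(k)$ means $i$ receives information from $j$; $N_i(k):=\{j\in V:(i,j)\in E(k)\}$, and $i\in N_i(k)$ always. $w_{ij}(k)$ are weights and $\alpha_k>0$ step sizes (deterministic). $\Omega_i(k)$ is a random variable with values in $I_i$. Algorithm (random projected proximal algorithm). Initial points $x_i(0)\in\mathbb{R}^d$ ($i\in V$)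 are arbitrary (possibly random). For $k\ge0$ and $i\in V$, $$v_i(k):=\sum_{j\in N_i(k)}w_{ij}(k)x_j(k),\qquad x_i(k+1):=P_{X_i^{\Omega_i(k)}}\big(\mathrm{prox}_{\alpha_kf_i}(v_i(k))\big).$$ *)

theory Defs
  imports "HOL-Probability.Probability" "Graph_Theory.Digraph_Component"
begin

definition user_set :: "(nat \<Rightarrow> nat set) \<Rightarrow> (nat \<Rightarrow> nat \<Rightarrow> 'a set) \<Rightarrow> nat \<Rightarrow> 'a set" where
  "user_set I X i = (\<Inter>j\<in>I i. X i j)"

definition feasible_set ::
    "nat set \<Rightarrow> (nat \<Rightarrow> nat set) \<Rightarrow> (nat \<Rightarrow> nat \<Rightarrow> 'a set) \<Rightarrow> 'a set" where
  "feasible_set V I X = (\<Inter>i\<in>V. user_set I X i)"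

definition objective :: "nat set \<Rightarrow> (nat \<Rightarrow> 'a \<Rightarrow> real) \<Rightarrow> 'a \<Rightarrow> real" where
  "objective V f x = (\<Sum>i\<in>V. f i x)"

(* The infimum is taken in the extended reals, because Inf on real is unspecified for sets that
   are not bounded below; an objective unbounded below on S has no minimizers. *)
definition minimizers :: "('a \<Rightarrow> real) \<Rightarrow> 'a set \<Rightarrow> 'a set" where
  "minimizers f S = {x \<in> S. ereal (f x) = (INF y\<in>S. ereal (f y))}"

definition subdifferential :: "('a::real_inner \<Rightarrow> real) \<Rightarrow> 'a \<Rightarrow> 'a set" where
  "subdifferential f x = {g. \<forall>y. f y \<ge> f x + g \<bullet> (y - x)}"

definition prox :: "('a::real_inner \<Rightarrow> real) \<Rightarrow> 'a \<Rightarrow> 'a" where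
  "prox g x = (THE y. is_arg_min (\<lambda>y. g y + 1/2 * (norm (x - y))\<^sup>2) (\<lambda>_. True) y)"

definition neighbours :: "nat set \<Rightarrow> (nat \<Rightarrow> (nat \<times> nat) set) \<Rightarrow> nat \<Rightarrow> nat \<Rightarrow> nat set" where
  "neighbours V E i k = {j \<in> V. (i, j) \<in> E k}"

(* The sigma-algebra on the sample space generated by the whole family (Y i), i in J,
   where Y i takes values in N i. *)
definition generated_events ::
    "'w measure \<Rightarrow> 'i set \<Rightarrow> ('i \<Rightarrow> 'b measure) \<Rightarrow> ('i \<Rightarrow> 'w \<Rightarrow> 'b) \<Rightarrow> 'w set set" where
  "generated_events P J N Y =
     sets (vimage_algebra (space P) (\<lambda>\<omega>. \<lambda>i\<in>J. Y i \<omega>) (Pi\<^sub>M J N))"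

end

theory Submission
  imports Defs
begin

text \<open>
  Condition (2) makes every single graph \<open>E k\<close> strongly connected, so each averaging step already
  decreases the sum \<open>D\<close> of squared distances to a point \<open>y\<close> of \<open>X\<close> by at least a constant times every
  \<open>(norm (x\<^sub>a - x\<^sub>b))\<^sup>2\<close>. Combining this with the proximal and projection inequalities, and writing \<open>v\<^sub>i\<close> and
  \<open>z\<^sub>i\<close> for the points before and after the proximal step, \<open>T\<close> for the variance lost by averaging and
  \<open>s\<close> for the projection on \<open>X\<close> of one fixed agent's iterate, Young's inequality yields pathwise
  \<open>D (k + 1) + T / 2 + \<Sigma> (norm (v\<^sub>i - z\<^sub>i))\<^sup>2 / 2 + \<Sigma> d(z\<^sub>i, S\<^sub>i)\<^sup>2 + 2 \<alpha>\<^sub>k (f s - f y)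
     \<le> D k + C \<alpha>\<^sub>k\<^sup>2 + \<Sigma> d(z\<^sub>i, X)\<^sup>2 / (2 c)\<close>, where \<open>S\<^sub>i\<close> is the randomly chosen set.
  Taking expectations for one optimal \<open>y\<close>, on an event where the initial points are bounded (they need
  not be integrable), condition (4) absorbs the last sum, so \<open>\<Sigma> d(z\<^sub>i, X)\<^sup>2\<close> over all times is finite
  almost surely. From there on the argument is deterministic, and no martingale convergence theorem is
  needed: for every optimal \<open>y\<close> the iterates are quasi-Fejer monotone, \<open>f(s) - f\<^sup>\<star>\<close> is summable against
  the non-summable \<open>\<alpha>\<close>, so some subsequence tends to an optimal point, and hence the whole sequence does.
\<close>

section \<open>Proximal and projection inequalities\<close>

text \<open>A hyperplane separating the point \<open>(x, f x)\<close> from the strict epigraph has a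
  normal \<open>(p, q)\<close> with \<open>q > 0\<close>, and its slope \<open>- p / q\<close> is a
  subgradient. Without existence, the assumed bound on subgradients would carry no
  information.\<close>

lemma subdifferential_nonempty:
  fixes f :: "'a::euclidean_space \<Rightarrow> real"
  assumes "convex_on UNIV f"
  shows "subdifferential f x \<noteq> {}"
proof -
  define T where "T = {z :: 'a \<times> real. f (fst z) < snd z}"
  have "convex T"
    unfolding convex_alt
  proof (intro ballI allI impI)
    fix a b and u :: real assume ab: "a \<in> T" "b \<in> T" and u: "0 \<le> u \<and> u \<le> 1"
    have "f ((1 - u) *\<^sub>R fst a + u *\<^sub>R fst b) \<le> (1 - u) * f (fst a) + u * f (fst b)"
      using convex_onD[OF assms, of u "fst a" "fst b"] u by auto
    also have "\<dots> < (1 - u) * snd a + u * snd b"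
    proof (cases "u = 0")
      case False
      have "(1 - u) * f (fst a) \<le> (1 - u) * snd a" "u * f (fst b) < u * snd b"
        using ab u False by (auto simp: T_def intro!: mult_left_mono)
      then show ?thesis by linarith
    qed (use ab in \<open>auto simp: T_def\<close>)
    finally show "(1 - u) *\<^sub>R a + u *\<^sub>R b \<in> T" by (simp add: T_def)
  qed
  moreover have "(x, f x + 1) \<in> T" by (simp add: T_def)
  moreover have "{(x, f x)} \<inter> T = {}" by (simp add: T_def)
  ultimately have "\<exists>a b. a \<noteq> 0 \<and> (\<forall>z\<in>{(x, f x)}. a \<bullet> z \<le> b) \<and> (\<forall>z\<in>T. a \<bullet> z \<ge> b)"
    by (intro separating_hyperplane_sets) auto
  then obtain a b where a: "a \<noteq> 0" "a \<bullet> (x, f x) \<le> b" "\<forall>z\<in>T. a \<bullet> z \<ge> b"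
    by blast
  obtain p q where pq: "a = (p, q)" by (cases a)
  have above: "p \<bullet> x + q * f x \<le> p \<bullet> y + q * t" if "f y < t" for y t
    using a(2) a(3)[rule_format, of "(y, t)"] that by (simp add: pq T_def)
  have q_nonneg: "q \<ge> 0"
    using above[of x "f x + 1"] by (simp add: algebra_simps)
  \<comment> \<open>A vertical hyperplane (\<open>q = 0\<close>) is impossible because
    \<open>f\<close> is finite everywhere: testing it above \<open>x - p\<close> forces
    \<open>p = 0\<close>, so the whole normal would vanish.\<close>
  have q_pos: "q > 0"
  proof (rule ccontr)
    assume "\<not> q > 0"
    with q_nonneg have "q = 0" by simp
    with above[of "x - p" "f (x - p) + 1"] have "p \<bullet> p \<le> 0"
      by (simp add: inner_diff_right)
    with \<open>q = 0\<close> a(1) pq show False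
      by (metis inner_ge_zero inner_eq_zero_iff order_antisym zero_prod_def)
  qed
  \<comment> \<open>The separation speaks of the strict epigraph only, so the inequality is shown
    for every \<open>t > f y\<close> and passes to \<open>f y\<close> by density.\<close>
  have "f y \<ge> f x + (- p /\<^sub>R q) \<bullet> (y - x)" for y
  proof (rule dense_ge)
    fix t assume "f y < t"
    have cancel: "q * (inverse q * r) = r" for r
      using q_pos by simp
    from above[OF \<open>f y < t\<close>] have "q * (f x + (- p /\<^sub>R q) \<bullet> (y - x)) \<le> q * t"
      by (simp add: algebra_simps inner_diff_right cancel)
    then show "f x + (- p /\<^sub>R q) \<bullet> (y - x) \<le> t"
      using q_pos by simp
  qed
  then show ?thesis unfolding subdifferential_def by blast
qed

text \<open>Only the subgradients at \<open>p\<close> enter, while \<open>z\<close> is arbitrary.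
  This matters because subgradients are bounded on the constraint sets alone, and the points
  produced by the proximal step may lie outside them.\<close>

lemma convex_lower_bound:
  fixes f :: "'a::euclidean_space \<Rightarrow> real"
  assumes "convex_on UNIV f" and "\<And>g. g \<in> subdifferential f p \<Longrightarrow> norm g \<le> B"
  shows "f z \<ge> f p - B * norm (z - p)"
proof -
  obtain g where g: "g \<in> subdifferential f p"
    using subdifferential_nonempty[OF assms(1)] by blast
  have "\<bar>g \<bullet> (z - p)\<bar> \<le> B * norm (z - p)"
    using Cauchy_Schwarz_ineq2[of g "z - p"] mult_right_mono[OF assms(2)[OF g], of "norm (z - p)"]
    by simp
  moreover have "f z \<ge> f p + g \<bullet> (z - p)"
    using g by (simp add: subdifferential_def)
  ultimately show ?thesis by linarith
qed

text \<open>Compare \<open>z\<close> with the points of the segment from \<open>z\<close> to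
  \<open>y\<close>; the first-order term gives \<open>A \<ge> 0\<close>, which is the variational
  inequality of the proximal point. It is stated for an arbitrary minimizer because uniqueness, and
  with it the meaning of \<open>prox\<close>, is derived from it.\<close>

lemma arg_min_prox_ineq:
  fixes f :: "'a::euclidean_space \<Rightarrow> real"
  assumes f: "convex_on UNIV f"
    and z: "is_arg_min (\<lambda>y. f y + 1/2 * (norm (v - y))\<^sup>2) (\<lambda>_. True) z"
  shows "(norm (z - y))\<^sup>2 \<le> (norm (v - y))\<^sup>2 - (norm (v - z))\<^sup>2 - 2 * (f z - f y)"
proof -
  define A where "A = f y - f z - (v - z) \<bullet> (y - z)"
  define B where "B = (norm (y - z))\<^sup>2 / 2"
  have small: "0 \<le> A + t * B" if t: "0 < t" "t \<le> 1" for t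
  proof -
    have min: "f z + 1/2 * (norm (v - z))\<^sup>2 \<le> f u + 1/2 * (norm (v - u))\<^sup>2" for u
      using z by (auto simp: is_arg_min_def not_less)
    have "f z + 1/2 * (norm (v - z))\<^sup>2
        \<le> f ((1 - t) *\<^sub>R z + t *\<^sub>R y) + 1/2 * (norm (v - ((1 - t) *\<^sub>R z + t *\<^sub>R y)))\<^sup>2"
      by (rule min)
    also have "f ((1 - t) *\<^sub>R z + t *\<^sub>R y) \<le> (1 - t) * f z + t * f y"
      using convex_onD[OF f, of t z y] t by auto
    also have "(norm (v - ((1 - t) *\<^sub>R z + t *\<^sub>R y)))\<^sup>2
        = (norm ((v - z) - t *\<^sub>R (y - z)))\<^sup>2"
      by (simp add: algebra_simps)
    also have "\<dots> = (norm (v - z))\<^sup>2 - 2 * t * ((v - z) \<bullet> (y - z)) + t\<^sup>2 * (norm (y - z))\<^sup>2"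
      unfolding power2_norm_eq_inner
      by (simp add: inner_diff_left inner_diff_right inner_commute power2_eq_square algebra_simps)
    finally have "0 \<le> t * (A + t * B)"
      by (simp add: A_def B_def algebra_simps power2_eq_square)
    with t show ?thesis by (simp add: zero_le_mult_iff)
  qed
  have "0 \<le> A"
  proof (rule ccontr)
    assume neg: "\<not> 0 \<le> A"
    have B: "B \<ge> 0" by (simp add: B_def)
    \<comment> \<open>This \<open>t\<close> makes \<open>t * B\<close> at most half of
      \<open>- A\<close>, so \<open>A + t * B\<close> would be negative.\<close>
    define t where "t = min 1 (- A / (2 * (B + 1)))"
    have t: "0 < t" "t \<le> 1" using neg B by (auto simp: t_def divide_neg_pos)
    have "t \<le> - A / (2 * (B + 1))" by (simp add: t_def)
    then have "t * (2 * (B + 1)) \<le> - A" using B by (subst (asm) pos_le_divide_eq) auto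
    with small[OF t] t neg B show False by (simp add: algebra_simps)
  qed
  moreover have "(norm (v - y))\<^sup>2 = (norm (v - z))\<^sup>2 + (norm (z - y))\<^sup>2 - 2 * ((v - z) \<bullet> (y - z))"
    unfolding power2_norm_eq_inner
    by (simp add: inner_diff_left inner_diff_right inner_commute algebra_simps)
  ultimately show ?thesis unfolding A_def by simp
qed

text \<open>The subgradient \<open>g\<close> at \<open>v\<close> makes the objective at least
  \<open>f v\<close> outside the ball of radius \<open>2 * norm g\<close>, so a minimizer on this
  compact ball is a global one. Uniqueness follows from the preceding inequality; both are required
  for the \<open>THE\<close> in \<open>prox\<close>.\<close>

lemma prox_is_arg_min:
  fixes f :: "'a::euclidean_space \<Rightarrow> real"
  assumes f: "convex_on UNIV f"
  shows "is_arg_min (\<lambda>y. f y + 1/2 * (norm (v - y))\<^sup>2) (\<lambda>_. True) (prox f v)"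
proof -
  let ?h = "\<lambda>y. f y + 1/2 * (norm (v - y))\<^sup>2"
  obtain g where g: "\<And>y. f y \<ge> f v + g \<bullet> (y - v)"
    using subdifferential_nonempty[OF f, of v] by (auto simp: subdifferential_def)
  have "continuous_on (cball v (2 * norm g)) ?h"
    by (intro continuous_intros continuous_on_subset[OF convex_on_continuous[OF open_UNIV f]]) auto
  then obtain z where z: "z \<in> cball v (2 * norm g)" "\<And>y. y \<in> cball v (2 * norm g) \<Longrightarrow> ?h z \<le> ?h y"
    using continuous_attains_inf[of "cball v (2 * norm g)" ?h] by auto
  have "?h z \<le> ?h y" for y
  proof (cases "y \<in> cball v (2 * norm g)")
    case False
    then have far: "norm (v - y) > 2 * norm g" by (simp add: dist_norm)
    have "\<bar>g \<bullet> (y - v)\<bar> \<le> norm g * norm (v - y)"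
      using Cauchy_Schwarz_ineq2[of g "y - v"] by (simp add: norm_minus_commute)
    also have "\<dots> \<le> 1/2 * (norm (v - y))\<^sup>2"
      using mult_right_mono[OF less_imp_le[OF far], of "norm (v - y)"] by (simp add: power2_eq_square)
    finally have "f v \<le> ?h y" using g[of y] by linarith
    moreover have "?h z \<le> f v" using z(2)[of v] by simp
    ultimately show ?thesis by linarith
  qed (use z in auto)
  then have "is_arg_min ?h (\<lambda>_. True) z" by (auto simp: is_arg_min_def not_less)
  moreover have "w = z" if w: "is_arg_min ?h (\<lambda>_. True) w" for w
  proof -
    have "(norm (w - z))\<^sup>2 \<le> 0"
      using arg_min_prox_ineq[OF f w, of z] \<open>\<And>y. ?h z \<le> ?h y\<close>[of w] by argo
    then show ?thesis by simp
  qed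
  ultimately show ?thesis unfolding prox_def by (rule theI)
qed

lemmas prox_ineq = arg_min_prox_ineq[OF _ prox_is_arg_min]

text \<open>In the sum of the proximal inequalities at \<open>v\<close> and at \<open>w\<close>,
  each tested at the other proximal point, the function values cancel. What remains is firm
  nonexpansiveness, and Cauchy-Schwarz finishes.\<close>

lemma prox_nonexpansive:
  fixes f :: "'a::euclidean_space \<Rightarrow> real"
  assumes "convex_on UNIV f"
  shows "norm (prox f v - prox f w) \<le> norm (v - w)"
proof -
  let ?a = "prox f v" and ?b = "prox f w"
  have "2 * (norm (?a - ?b))\<^sup>2
      \<le> (norm (v - ?b))\<^sup>2 - (norm (v - ?a))\<^sup>2 + (norm (w - ?a))\<^sup>2 - (norm (w - ?b))\<^sup>2"
    using prox_ineq[OF assms assms, of v ?b] prox_ineq[OF assms assms, of w ?a]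
    by (simp add: norm_minus_commute)
  also have "\<dots> = 2 * ((v - w) \<bullet> (?a - ?b))"
    unfolding power2_norm_eq_inner
    by (simp add: inner_diff_left inner_diff_right inner_commute algebra_simps)
  also have "\<dots> \<le> 2 * (norm (v - w) * norm (?a - ?b))"
    by (intro mult_left_mono norm_cauchy_schwarz) auto
  finally have "norm (?a - ?b) * norm (?a - ?b) \<le> norm (v - w) * norm (?a - ?b)"
    by (simp add: power2_eq_square)
  then show ?thesis
    by (cases "norm (?a - ?b) = 0") (auto simp: mult_le_cancel_right)
qed

lemma continuous_on_prox:
  fixes f :: "'a::euclidean_space \<Rightarrow> real"
  assumes "convex_on UNIV f"
  shows "continuous_on S (prox f)"
  unfolding continuous_on_iff
  using prox_nonexpansive[OF assms] by (metis dist_norm order_le_less_trans)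

section \<open>Distance gain of the metric projection\<close>

lemma infdist_closest_point:
  fixes S :: "'a::euclidean_space set"
  assumes "closed S" "S \<noteq> {}"
  shows "infdist z S = norm (z - closest_point S z)"
  using assms setdist_closest_point[of S z] by (simp add: infdist_eq_setdist dist_norm)

text \<open>The angle at the projection is not acute, so Pythagoras holds as an inequality. The
  subtracted squared distance is the gain that condition (4) later compares with the distance to
  \<open>X\<close>.\<close>

lemma closest_point_ineq:
  fixes S :: "'a::euclidean_space set"
  assumes "closed S" "convex S" "y \<in> S"
  shows "(norm (closest_point S z - y))\<^sup>2 \<le> (norm (z - y))\<^sup>2 - (infdist z S)\<^sup>2"
proof -
  let ?p = "closest_point S z"
  have "(norm (z - y))\<^sup>2 = (norm (z - ?p))\<^sup>2 + (norm (?p - y))\<^sup>2 - 2 * ((z - ?p) \<bullet> (y - ?p))"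
    unfolding power2_norm_eq_inner
    by (simp add: inner_diff_left inner_diff_right inner_commute algebra_simps)
  moreover have "(z - ?p) \<bullet> (y - ?p) \<le> 0"
    by (rule closest_point_dot) (use assms in auto)
  moreover have "infdist z S = norm (z - ?p)"
    by (rule infdist_closest_point) (use assms in auto)
  ultimately show ?thesis by simp
qed

section \<open>Averaging and the descent inequality\<close>

text \<open>Bias-variance decomposition around the weighted mean.\<close>

lemma weighted_variance:
  fixes x :: "'i \<Rightarrow> 'a::real_inner"
  assumes "(\<Sum>j\<in>V. w j) = 1"
  shows "(norm ((\<Sum>j\<in>V. w j *\<^sub>R x j) - y))\<^sup>2
      = (\<Sum>j\<in>V. w j * (norm (x j - y))\<^sup>2) - (\<Sum>j\<in>V. w j * (norm (x j - (\<Sum>l\<in>V. w l *\<^sub>R x l)))\<^sup>2)"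
proof -
  define v where "v = (\<Sum>l\<in>V. w l *\<^sub>R x l)"
  have "w j * (norm (x j - y))\<^sup>2 = w j * (norm (x j - v))\<^sup>2 + w j * ((norm (v - y))\<^sup>2 - 2 * ((v - y) \<bullet> v))
      + 2 * (w j * ((v - y) \<bullet> x j))" for j
    unfolding power2_norm_eq_inner
    by (simp add: inner_diff_left inner_diff_right inner_commute algebra_simps)
  then have "(\<Sum>j\<in>V. w j * (norm (x j - y))\<^sup>2)
      = (\<Sum>j\<in>V. w j * (norm (x j - v))\<^sup>2) + (\<Sum>j\<in>V. w j) * ((norm (v - y))\<^sup>2 - 2 * ((v - y) \<bullet> v))
        + 2 * (\<Sum>j\<in>V. w j * ((v - y) \<bullet> x j))"
    by (simp only: sum.distrib sum_distrib_right sum_distrib_left)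
  also have "(\<Sum>j\<in>V. w j * ((v - y) \<bullet> x j)) = (v - y) \<bullet> v"
    by (simp add: v_def inner_sum_right)
  finally show ?thesis using assms by (simp add: v_def)
qed

text \<open>Unit row sums allow the variance decomposition for each agent; unit column sums make the
  double sum of squared distances to \<open>y\<close> collapse to a single one.\<close>

lemma doubly_stochastic_variance:
  fixes x :: "'i \<Rightarrow> 'a::real_inner"
  assumes "\<And>i. i \<in> V \<Longrightarrow> (\<Sum>j\<in>V. W i j) = 1" "\<And>j. j \<in> V \<Longrightarrow> (\<Sum>i\<in>V. W i j) = 1"
    and v: "\<And>i. i \<in> V \<Longrightarrow> v i = (\<Sum>j\<in>V. W i j *\<^sub>R x j)"
  shows "(\<Sum>i\<in>V. (norm (v i - y))\<^sup>2)
      = (\<Sum>j\<in>V. (norm (x j - y))\<^sup>2) - (\<Sum>i\<in>V. \<Sum>j\<in>V. W i j * (norm (x j - v i))\<^sup>2)"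
proof -
  have "(\<Sum>i\<in>V. (norm (v i - y))\<^sup>2) = (\<Sum>i\<in>V. (\<Sum>j\<in>V. W i j * (norm (x j - y))\<^sup>2)
      - (\<Sum>j\<in>V. W i j * (norm (x j - v i))\<^sup>2))"
    using assms(1) by (intro sum.cong refl) (simp add: weighted_variance v)
  moreover have "(\<Sum>i\<in>V. \<Sum>j\<in>V. W i j * (norm (x j - y))\<^sup>2) = (\<Sum>j\<in>V. (norm (x j - y))\<^sup>2)"
    by (subst sum.swap) (simp add: sum_distrib_right[symmetric] assms(2))
  ultimately show ?thesis by (simp add: sum_subtractf)
qed

lemma relpow_dist_le:
  fixes x :: "'i \<Rightarrow> 'a::metric_space"
  assumes "\<And>a b. (a, b) \<in> R \<Longrightarrow> dist (x a) (x b) \<le> \<delta>" "(a, b) \<in> R ^^ n"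
  shows "dist (x a) (x b) \<le> n * \<delta>"
  using assms(2)
proof (induction n arbitrary: b)
  case (Suc n)
  then obtain c where "(a, c) \<in> R ^^ n" "(c, b) \<in> R" by auto
  then show ?case
    using Suc.IH[of c] assms(1)[of c b] dist_triangle[of "x a" "x b" "x c"] by (simp add: algebra_simps)
qed simp

text \<open>If \<open>(i, j)\<close> is an edge, both \<open>x i\<close> and \<open>x j\<close> are
  near the same point \<open>v i\<close>, hence near each other; following a path from
  \<open>a\<close> to \<open>b\<close> adds up these distances. The \<open>v i\<close> may be
  arbitrary, since each serves only as an intermediate point.\<close>

lemma strongly_connected_variance:
  fixes x :: "'i \<Rightarrow> 'a::real_inner"
  assumes "finite V" "R \<subseteq> V \<times> V" "(a, b) \<in> R\<^sup>*"
    and W0: "\<And>i j. i \<in> V \<Longrightarrow> j \<in> V \<Longrightarrow> W i j \<ge> 0"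
    and w: "w > 0" "\<And>i. i \<in> V \<Longrightarrow> W i i \<ge> w" "\<And>i j. (i, j) \<in> R \<Longrightarrow> W i j \<ge> w"
  shows "w * (norm (x a - x b))\<^sup>2
      \<le> 2 * (real (card V))^4 * (\<Sum>i\<in>V. \<Sum>j\<in>V. W i j * (norm (x j - v i))\<^sup>2)"
proof -
  define T where "T = (\<Sum>i\<in>V. \<Sum>j\<in>V. W i j * (norm (x j - v i))\<^sup>2)"
  have T0: "T \<ge> 0" unfolding T_def by (intro sum_nonneg mult_nonneg_nonneg W0) auto
  define \<delta> where "\<delta> = sqrt (2 * T / w)"
  have \<delta>0: "\<delta> \<ge> 0" using T0 w by (simp add: \<delta>_def)
  \<comment> \<open>In row \<open>i\<close> only the summands \<open>i\<close> and \<open>j\<close>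
    are kept. The first has a large weight because every vertex carries a self-loop.\<close>
  have edge: "dist (x i) (x j) \<le> \<delta>" if ij: "(i, j) \<in> R" for i j
  proof (cases "i = j")
    case False
    have V: "i \<in> V" "j \<in> V" using ij assms(2) by auto
    have "w * (norm (x i - v i))\<^sup>2 + w * (norm (x j - v i))\<^sup>2
        \<le> W i i * (norm (x i - v i))\<^sup>2 + W i j * (norm (x j - v i))\<^sup>2"
      by (intro add_mono mult_right_mono w V ij) auto
    also have "\<dots> = (\<Sum>l\<in>{i, j}. W i l * (norm (x l - v i))\<^sup>2)"
      using False by simp
    also have "\<dots> \<le> (\<Sum>l\<in>V. W i l * (norm (x l - v i))\<^sup>2)"
      using V W0 by (intro sum_mono2 assms(1)) auto
    also have "\<dots> \<le> T"
      unfolding T_def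
      using member_le_sum[of i V "\<lambda>i. \<Sum>j\<in>V. W i j * (norm (x j - v i))\<^sup>2"] V W0 assms(1)
      by (simp add: sum_nonneg)
    finally have "w * ((norm (x i - v i))\<^sup>2 + (norm (x j - v i))\<^sup>2) \<le> T"
      by (simp add: algebra_simps)
    moreover have "(dist (x i) (x j))\<^sup>2 \<le> 2 * ((norm (x i - v i))\<^sup>2 + (norm (x j - v i))\<^sup>2)"
    proof -
      have "dist (x i) (x j) \<le> norm (x i - v i) + norm (x j - v i)"
        by (metis dist_norm dist_triangle2)
      then have "(dist (x i) (x j))\<^sup>2 \<le> (norm (x i - v i) + norm (x j - v i))\<^sup>2"
        by (intro power_mono) auto
      also have "\<dots> \<le> 2 * ((norm (x i - v i))\<^sup>2 + (norm (x j - v i))\<^sup>2)"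
        using sum_squares_bound[of "norm (x i - v i)" "norm (x j - v i)"]
        by (simp add: power2_sum)
      finally show ?thesis .
    qed
    ultimately have "w * (dist (x i) (x j))\<^sup>2 \<le> 2 * T"
      using w(1) mult_left_mono[OF \<open>(dist (x i) (x j))\<^sup>2 \<le> _\<close>, of w] by linarith
    then have "(dist (x i) (x j))\<^sup>2 \<le> 2 * T / w"
      using w(1) by (simp add: pos_le_divide_eq mult.commute)
    then show ?thesis unfolding \<delta>_def by (rule real_le_rsqrt)
  qed (use \<delta>0 in simp)
  have fin: "finite R" using assms(1,2) finite_subset by blast
  \<comment> \<open>A path needs at most \<open>card R\<close> edges, and this crude bound by
    \<open>(card V)\<^sup>2\<close>, squared once more, is the source of the fourth power.\<close>
  have "card R \<le> (card V)\<^sup>2"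
    using card_mono[OF _ assms(2)] assms(1) by (simp add: card_cartesian_product power2_eq_square)
  obtain n where n: "n \<le> card R" "(a, b) \<in> R ^^ n"
    using assms(3) rtrancl_finite_eq_relpow[OF fin] by auto
  have "dist (x a) (x b) \<le> n * \<delta>"
    by (rule relpow_dist_le[OF edge n(2)])
  also have "\<dots> \<le> (card V)\<^sup>2 * \<delta>"
    using n(1) \<open>card R \<le> (card V)\<^sup>2\<close> \<delta>0 by (intro mult_right_mono) auto
  finally have "(dist (x a) (x b))\<^sup>2 \<le> ((card V)\<^sup>2 * \<delta>)\<^sup>2"
    by (intro power_mono) auto
  also have "\<dots> = (real (card V))^4 * (2 * T / w)"
    using T0 w by (simp add: \<delta>_def power_mult_distrib)
  finally have "(dist (x a) (x b))\<^sup>2 * w \<le> (real (card V))^4 * (2 * T / w) * w"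
    using w(1) by (intro mult_right_mono) auto
  then show ?thesis using w(1) by (simp add: T_def dist_norm algebra_simps)
qed

section \<open>Descent of one averaged, proximal and projected step\<close>

lemma weighted_am_gm:
  fixes a b \<eta> :: real
  assumes "\<eta> > 0"
  shows "2 * a * b \<le> \<eta> * a\<^sup>2 + b\<^sup>2 / \<eta>"
proof -
  have "0 \<le> (\<eta> * a - b)\<^sup>2 / \<eta>" using assms by simp
  also have "\<dots> = \<eta> * a\<^sup>2 + b\<^sup>2 / \<eta> - 2 * a * b"
    using assms by (simp add: power2_eq_square field_simps)
  finally show ?thesis by simp
qed

text \<open>The proximal inequality yields \<open>f z - f y\<close>, but subgradients are controlled
  only on \<open>Y\<close>. So \<open>f z\<close> is compared with the value at \<open>s\<close>,
  the projection on \<open>Y\<close> of a reference point \<open>u\<close>, at the cost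
  \<open>M * norm (z - s)\<close>. Since \<open>u\<close> is common to all agents, the values at
  \<open>s\<close> add up to the full objective at one feasible point.\<close>

lemma projected_prox_step:
  fixes f :: "'a::euclidean_space \<Rightarrow> real"
  assumes f: "convex_on UNIV f" and \<alpha>: "\<alpha> > 0"
    and M: "\<And>p g. p \<in> Y \<Longrightarrow> g \<in> subdifferential f p \<Longrightarrow> norm g \<le> M" "M \<ge> 0"
    and Y: "closed Y" "y \<in> Y" and S: "closed S" "convex S" "Y \<subseteq> S"
    and c: "c > 0" and \<eta>: "\<eta> > 0"
    and z: "z = prox (\<lambda>y. \<alpha> * f y) v"
  shows "(norm (closest_point S z - y))\<^sup>2 + (norm (v - z))\<^sup>2 / 2 + (infdist z S)\<^sup>2
           + 2 * \<alpha> * (f (closest_point Y u) - f y)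
         \<le> (norm (v - y))\<^sup>2 + \<eta> * (norm (v - u))\<^sup>2 + (infdist z Y)\<^sup>2 / (2 * c)
           + (8 + 4 / \<eta> + 2 * c) * M\<^sup>2 * \<alpha>\<^sup>2"
proof -
  define s where "s = closest_point Y u"
  have s: "s \<in> Y" unfolding s_def using Y by (intro closest_point_in_set) auto
  have f\<alpha>: "convex_on UNIV (\<lambda>y. \<alpha> * f y)"
    using f \<alpha> by (intro convex_on_cmul) auto
  have proj: "(norm (closest_point S z - y))\<^sup>2 \<le> (norm (z - y))\<^sup>2 - (infdist z S)\<^sup>2"
    using closest_point_ineq[of S y z] S Y by auto
  have prox: "(norm (z - y))\<^sup>2 \<le> (norm (v - y))\<^sup>2 - (norm (v - z))\<^sup>2 - 2 * \<alpha> * (f z - f y)"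
    using prox_ineq[OF f\<alpha> f\<alpha>, of v y] by (simp add: z algebra_simps)
  \<comment> \<open>The way from \<open>z\<close> to \<open>s\<close> leads through
    \<open>u\<close>, and the distance from \<open>u\<close> to \<open>Y\<close> is bounded through
    \<open>z\<close> again; \<open>norm (z - u)\<close> is therefore counted twice.\<close>
  have "norm (z - s) \<le> 2 * norm (v - z) + 2 * norm (v - u) + infdist z Y"
  proof -
    have "norm (z - s) \<le> norm (z - u) + norm (u - s)" by norm
    also have "norm (u - s) = infdist u Y"
      unfolding s_def using Y by (subst infdist_closest_point) auto
    also have "infdist u Y \<le> infdist z Y + norm (z - u)"
      using infdist_triangle[of u Y z] by (simp add: dist_norm norm_minus_commute)
    also have "norm (z - u) \<le> norm (v - z) + norm (v - u)" by norm
    finally show ?thesis by simp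
  qed
  then have "M * norm (z - s) \<le> M * (2 * norm (v - z) + 2 * norm (v - u) + infdist z Y)"
    using M(2) by (rule mult_left_mono)
  moreover have "f z \<ge> f s - M * norm (z - s)"
    using f M(1)[OF s] by (rule convex_lower_bound)
  ultimately have "f s - M * (2 * norm (v - z) + 2 * norm (v - u) + infdist z Y) \<le> f z"
    by linarith
  from mult_left_mono[OF this, of "2 * \<alpha>"] \<alpha>
  have "2 * \<alpha> * f s - 2 * \<alpha> * f z
      \<le> 4 * (\<alpha> * M) * norm (v - z) + 4 * (\<alpha> * M) * norm (v - u) + 2 * (\<alpha> * M) * infdist z Y"
    by (simp add: algebra_simps)
  \<comment> \<open>Young's inequality with the weights 1/2, \<open>\<eta>\<close> and
    \<open>1 / (2 * c)\<close>. The first uses up half of the gain of the proximal step; the other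
    two are paid for by the variance lost in averaging and, in expectation, by the gain of the
    random projection.\<close>
  moreover have "4 * (\<alpha> * M) * norm (v - z) \<le> (norm (v - z))\<^sup>2 / 2 + 8 * (\<alpha> * M)\<^sup>2"
    using weighted_am_gm[of "1/2" "norm (v - z)" "2 * (\<alpha> * M)"] by (simp add: power_mult_distrib algebra_simps)
  moreover have "4 * (\<alpha> * M) * norm (v - u) \<le> \<eta> * (norm (v - u))\<^sup>2 + 4 / \<eta> * (\<alpha> * M)\<^sup>2"
    using weighted_am_gm[OF \<eta>, of "norm (v - u)" "2 * (\<alpha> * M)"] by (simp add: power_mult_distrib algebra_simps)
  moreover have "2 * (\<alpha> * M) * infdist z Y \<le> (infdist z Y)\<^sup>2 / (2 * c) + 2 * c * (\<alpha> * M)\<^sup>2"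
    using weighted_am_gm[of "1 / (2 * c)" "infdist z Y" "\<alpha> * M"] c by (simp add: algebra_simps)
  moreover have "(8 + 4 / \<eta> + 2 * c) * M\<^sup>2 * \<alpha>\<^sup>2
      = 8 * (\<alpha> * M)\<^sup>2 + 4 / \<eta> * (\<alpha> * M)\<^sup>2 + 2 * c * (\<alpha> * M)\<^sup>2"
    by (simp add: power_mult_distrib algebra_simps)
  ultimately show ?thesis
    using proj prox unfolding s_def[symmetric] by (simp add: algebra_simps)
qed

text \<open>Jensen's inequality for the squared norm, applied to a convex combination.\<close>

lemma average_spread:
  fixes x :: "'i \<Rightarrow> 'a::real_inner"
  assumes w: "\<And>j. j \<in> V \<Longrightarrow> w j \<ge> 0" "(\<Sum>j\<in>V. w j) = 1"
    and \<kappa>: "\<kappa> \<ge> 0" and spread: "\<And>j. j \<in> V \<Longrightarrow> \<kappa> * (norm (x j - u))\<^sup>2 \<le> T"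
  shows "\<kappa> * (norm ((\<Sum>j\<in>V. w j *\<^sub>R x j) - u))\<^sup>2 \<le> T"
proof -
  have "(norm ((\<Sum>j\<in>V. w j *\<^sub>R x j) - u))\<^sup>2 \<le> (\<Sum>j\<in>V. w j * (norm (x j - u))\<^sup>2)"
    using weighted_variance[OF w(2), of x u] w(1) by (simp add: sum_nonneg)
  then have "\<kappa> * (norm ((\<Sum>j\<in>V. w j *\<^sub>R x j) - u))\<^sup>2 \<le> \<kappa> * (\<Sum>j\<in>V. w j * (norm (x j - u))\<^sup>2)"
    using \<kappa> by (rule mult_left_mono)
  also have "\<dots> = (\<Sum>j\<in>V. w j * (\<kappa> * (norm (x j - u))\<^sup>2))"
    by (simp add: sum_distrib_left algebra_simps)
  also have "\<dots> \<le> (\<Sum>j\<in>V. w j * T)"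
    using w(1) spread by (intro sum_mono mult_left_mono) auto
  also have "\<dots> = T" using w(2) by (simp add: sum_distrib_right[symmetric])
  finally show ?thesis .
qed

text \<open>The one-agent inequalities are summed with the iterate of agent \<open>i0\<close> as
  reference point. Averaging gains \<open>T\<close>, and half of it pays for the distances of the
  \<open>v i\<close> to the reference point.\<close>

lemma distributed_step:
  fixes f :: "'i \<Rightarrow> 'a::euclidean_space \<Rightarrow> real"
  assumes V: "finite V" "i0 \<in> V"
    and f: "\<And>i. i \<in> V \<Longrightarrow> convex_on UNIV (f i)" and \<alpha>: "\<alpha> > 0"
    and M: "\<And>i p g. i \<in> V \<Longrightarrow> p \<in> Y \<Longrightarrow> g \<in> subdifferential (f i) p \<Longrightarrow> norm g \<le> M" "M \<ge> 0"
    and Y: "closed Y" "y \<in> Y"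
    and S: "\<And>i. i \<in> V \<Longrightarrow> closed (S i) \<and> convex (S i) \<and> Y \<subseteq> S i"
    and c: "c > 0" and \<kappa>: "\<kappa> > 0"
    and W: "\<And>i j. i \<in> V \<Longrightarrow> j \<in> V \<Longrightarrow> W i j \<ge> 0"
      "\<And>i. i \<in> V \<Longrightarrow> (\<Sum>j\<in>V. W i j) = 1" "\<And>j. j \<in> V \<Longrightarrow> (\<Sum>i\<in>V. W i j) = 1"
    and v: "\<And>i. i \<in> V \<Longrightarrow> v i = (\<Sum>j\<in>V. W i j *\<^sub>R x j)"
    and z: "\<And>i. i \<in> V \<Longrightarrow> z i = prox (\<lambda>y. \<alpha> * f i y) (v i)"
    and x': "\<And>i. i \<in> V \<Longrightarrow> x' i = closest_point (S i) (z i)"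
    and T: "T = (\<Sum>i\<in>V. \<Sum>j\<in>V. W i j * (norm (x j - v i))\<^sup>2)"
    and spread: "\<And>a b. a \<in> V \<Longrightarrow> b \<in> V \<Longrightarrow> \<kappa> * (norm (x a - x b))\<^sup>2 \<le> T"
  shows "(\<Sum>i\<in>V. (norm (x' i - y))\<^sup>2) + T / 2 + (\<Sum>i\<in>V. (norm (v i - z i))\<^sup>2) / 2
      + (\<Sum>i\<in>V. (infdist (z i) (S i))\<^sup>2)
      + 2 * \<alpha> * ((\<Sum>i\<in>V. f i (closest_point Y (x i0))) - (\<Sum>i\<in>V. f i y))
    \<le> (\<Sum>i\<in>V. (norm (x i - y))\<^sup>2) + (\<Sum>i\<in>V. (infdist (z i) Y)\<^sup>2) / (2 * c)
      + card V * (8 + 8 * card V / \<kappa> + 2 * c) * M\<^sup>2 * \<alpha>\<^sup>2"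
proof -
  have card: "card V > 0" using V by (auto simp: card_gt_0_iff)
  \<comment> \<open>With this weight each agent spends at most \<open>T / (2 * card V)\<close>,
    hence all of them together at most \<open>T / 2\<close>. It turns the constant
    \<open>4 / \<eta>\<close> into \<open>8 * card V / \<kappa>\<close>.\<close>
  define \<eta> where "\<eta> = \<kappa> / (2 * card V)"
  have \<eta>: "\<eta> > 0" using \<kappa> card by (simp add: \<eta>_def)
  let ?u = "x i0" and ?K = "(8 + 4 / \<eta> + 2 * c) * M\<^sup>2 * \<alpha>\<^sup>2"
  have mean: "\<eta> * (norm (v i - ?u))\<^sup>2 \<le> T / (2 * card V)" if i: "i \<in> V" for i
  proof -
    have "\<kappa> * (norm (v i - ?u))\<^sup>2 \<le> T"
      unfolding v[OF i] using W(1,2)[OF i] \<kappa> spread V(2) by (intro average_spread) auto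
    then show ?thesis using card by (simp add: \<eta>_def divide_right_mono)
  qed
  have "(\<Sum>i\<in>V. (norm (x' i - y))\<^sup>2 + (norm (v i - z i))\<^sup>2 / 2 + (infdist (z i) (S i))\<^sup>2
           + 2 * \<alpha> * (f i (closest_point Y ?u) - f i y))
      \<le> (\<Sum>i\<in>V. (norm (v i - y))\<^sup>2 + T / (2 * card V) + (infdist (z i) Y)\<^sup>2 / (2 * c) + ?K)"
  proof (rule sum_mono)
    fix i assume i: "i \<in> V"
    show "(norm (x' i - y))\<^sup>2 + (norm (v i - z i))\<^sup>2 / 2 + (infdist (z i) (S i))\<^sup>2
           + 2 * \<alpha> * (f i (closest_point Y ?u) - f i y)
      \<le> (norm (v i - y))\<^sup>2 + T / (2 * card V) + (infdist (z i) Y)\<^sup>2 / (2 * c) + ?K"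
    proof -
      have "(norm (closest_point (S i) (z i) - y))\<^sup>2 + (norm (v i - z i))\<^sup>2 / 2 + (infdist (z i) (S i))\<^sup>2
          + 2 * \<alpha> * (f i (closest_point Y ?u) - f i y)
        \<le> (norm (v i - y))\<^sup>2 + \<eta> * (norm (v i - ?u))\<^sup>2 + (infdist (z i) Y)\<^sup>2 / (2 * c) + ?K"
        by (rule projected_prox_step[OF f[OF i] \<alpha> M(1)[OF i] M(2) Y _ _ _ c \<eta> z[OF i]])
           (use S[OF i] in auto)
      then show ?thesis using mean[OF i] unfolding x'[OF i] by linarith
    qed
  qed
  also have "\<dots> = (\<Sum>i\<in>V. (norm (v i - y))\<^sup>2) + T / 2 + (\<Sum>i\<in>V. (infdist (z i) Y)\<^sup>2) / (2 * c) + card V * ?K"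
    using card by (simp add: sum.distrib sum_divide_distrib)
  also have "(\<Sum>i\<in>V. (norm (v i - y))\<^sup>2) = (\<Sum>i\<in>V. (norm (x i - y))\<^sup>2) - T"
    unfolding T by (rule doubly_stochastic_variance[OF W(2,3) v])
  finally show ?thesis
    by (simp add: sum.distrib sum_divide_distrib[symmetric] sum_distrib_left[symmetric]
        sum_subtractf \<eta>_def algebra_simps)
qed

section \<open>Quasi-Fejer convergence\<close>

text \<open>Telescoping bounds the partial sums of \<open>u\<close>, and subtracting the accumulated
  errors from \<open>a\<close> leaves a decreasing sequence that is bounded below. It is applied
  along single paths and also to the sequence of expectations.\<close>

lemma quasi_Fejer_monotone:
  fixes a u \<beta> :: "nat \<Rightarrow> real"
  assumes step: "\<And>k. a (Suc k) + u k \<le> a k + \<beta> k"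
    and nonneg: "\<And>k. a k \<ge> 0" "\<And>k. u k \<ge> 0" "\<And>k. \<beta> k \<ge> 0" and \<beta>: "summable \<beta>"
  shows "convergent a" and "summable u"
proof -
  have le: "(\<Sum>l<k. \<beta> l) \<le> suminf \<beta>" for k
    using \<beta> nonneg(3) by (intro sum_le_suminf) auto
  have bound: "a k + (\<Sum>l<k. u l) \<le> a 0 + (\<Sum>l<k. \<beta> l)" for k
  proof (induction k)
    case (Suc k)
    then show ?case using step[of k] by simp
  qed simp
  show "summable u"
  proof (rule bounded_imp_summable)
    show "(\<Sum>l\<le>k. u l) \<le> a 0 + suminf \<beta>" for k
      using bound[of "Suc k"] le[of "Suc k"] nonneg(1)[of "Suc k"]
      unfolding lessThan_Suc_atMost by linarith
  qed (rule nonneg(2))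
  define b where "b k = a k - (\<Sum>l<k. \<beta> l)" for k
  have "decseq b"
    unfolding decseq_Suc_iff b_def using step nonneg(2) by (smt (verit) sum.lessThan_Suc)
  moreover have "b k \<ge> - suminf \<beta>" for k
    using le[of k] nonneg(1)[of k] by (simp add: b_def)
  ultimately obtain L where "b \<longlonglongrightarrow> L"
    using decseq_convergent[of b "- suminf \<beta>"] by blast
  then have "(\<lambda>k. b k + (\<Sum>l<k. \<beta> l)) \<longlonglongrightarrow> L + suminf \<beta>"
    using summable_LIMSEQ[OF \<beta>] by (rule tendsto_add)
  then show "convergent a" unfolding b_def by (auto simp: convergent_def)
qed

text \<open>Since the errors are summable, \<open>D y\<close> converges for every optimal
  \<open>y\<close>, and \<open>e\<close> is small infinitely often because \<open>\<alpha>\<close>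
  is not summable. A limit point of the corresponding projections \<open>s\<close> is optimal, and
  \<open>D\<close> at this point vanishes along a subsequence, hence in the limit. The step is
  assumed for all optimal \<open>y\<close> because the right one is found only at the end.\<close>

lemma quasi_Fejer_convergence:
  fixes x :: "'i \<Rightarrow> nat \<Rightarrow> 'a::euclidean_space" and F :: "'a \<Rightarrow> real"
  assumes V: "finite V" "i0 \<in> V"
    and Y: "closed Y" and F: "continuous_on UNIV F"
    and y0: "y0 \<in> Y" "\<And>p. p \<in> Y \<Longrightarrow> F y0 \<le> F p"
    and step: "\<And>y k. y \<in> Y \<Longrightarrow> F y = F y0 \<Longrightarrow>
       (\<Sum>i\<in>V. (norm (x i (Suc k) - y))\<^sup>2) + r k + 2 * \<alpha> k * (F (closest_point Y (x i0 k)) - F y)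
         \<le> (\<Sum>i\<in>V. (norm (x i k - y))\<^sup>2) + \<beta> k"
    and r: "\<And>k. r k \<ge> 0" and \<beta>: "\<And>k. \<beta> k \<ge> 0" "summable \<beta>"
    and \<alpha>: "\<And>k. \<alpha> k > 0" "\<not> summable \<alpha>"
    and \<kappa>: "\<kappa> > 0" and spread: "\<And>a k. a \<in> V \<Longrightarrow> \<kappa> * (norm (x a k - x i0 k))\<^sup>2 \<le> r k"
    and infeasibility: "\<And>k. \<kappa> * (infdist (x i0 k) Y)\<^sup>2 \<le> r k + \<beta> k"
  shows "\<exists>y\<in>Y. F y = F y0 \<and> (\<forall>i\<in>V. x i \<longlonglongrightarrow> y)"
proof -
  define s where "s k = closest_point Y (x i0 k)" for k
  have s_in: "s k \<in> Y" for k
    unfolding s_def using Y y0 by (intro closest_point_in_set) auto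
  define D where "D y k = (\<Sum>i\<in>V. (norm (x i k - y))\<^sup>2)" for y k
  define e where "e k = F (s k) - F y0" for k
  have e0: "e k \<ge> 0" for k using y0(2)[OF s_in] by (simp add: e_def)
  have D0: "D y k \<ge> 0" for y k by (simp add: D_def sum_nonneg)
  have step': "D y (Suc k) + (r k + 2 * \<alpha> k * e k) \<le> D y k + \<beta> k" if "y \<in> Y" "F y = F y0" for y k
    using step[OF that, of k] that(2) by (simp add: D_def s_def e_def)
  have u0: "r k + 2 * \<alpha> k * e k \<ge> 0" for k using r[of k] \<alpha>(1)[of k] e0[of k] by simp
  have D_conv: "convergent (D y)" if "y \<in> Y" "F y = F y0" for y
    by (rule quasi_Fejer_monotone(1)[OF step' D0 u0 \<beta>]) (fact that)+
  have u_sum: "summable (\<lambda>k. r k + 2 * \<alpha> k * e k)"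
    by (rule quasi_Fejer_monotone(2)[OF step' D0 u0 \<beta>]) (use y0 in auto)
  have r_sum: "summable r" and \<alpha>e_sum: "summable (\<lambda>k. 2 * \<alpha> k * e k)"
    by (rule summable_comparison_test_ev[OF _ u_sum];
        use r \<alpha>(1) e0 in \<open>auto intro!: always_eventually simp: less_imp_le\<close>)+
  \<comment> \<open>Polymorphic in the normed space, to serve for the disagreement vectors and for
    the real distances to \<open>Y\<close>.\<close>
  have sq_tendsto: "(\<lambda>k. norm (w k)) \<longlonglongrightarrow> 0"
    if "\<And>k. \<kappa> * (norm (w k))\<^sup>2 \<le> q k" "q \<longlonglongrightarrow> 0" for w :: "nat \<Rightarrow> 'b::real_normed_vector" and q
  proof -
    have "(\<lambda>k. (norm (w k))\<^sup>2) \<longlonglongrightarrow> 0"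
    proof (rule tendsto_sandwich[where f = "\<lambda>_. 0"])
      show "(\<lambda>k. q k / \<kappa>) \<longlonglongrightarrow> 0" using tendsto_divide[OF that(2) tendsto_const[of \<kappa>]] \<kappa> by simp
    qed (use that(1) \<kappa> in \<open>auto intro!: always_eventually simp: pos_le_divide_eq mult.commute\<close>)
    from tendsto_real_sqrt[OF this] show ?thesis by simp
  qed
  have r_lim: "r \<longlonglongrightarrow> 0" and \<beta>_lim: "\<beta> \<longlonglongrightarrow> 0"
    using summable_LIMSEQ_zero[OF r_sum] summable_LIMSEQ_zero[OF \<beta>(2)] by auto
  have consensus: "(\<lambda>k. x a k - x i0 k) \<longlonglongrightarrow> 0" if "a \<in> V" for a
    by (rule tendsto_norm_zero_cancel, rule sq_tendsto[OF spread r_lim]) (fact that)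
  have "(\<lambda>k. norm (infdist (x i0 k) Y)) \<longlonglongrightarrow> 0"
  proof (rule sq_tendsto)
    show "\<kappa> * (norm (infdist (x i0 k) Y))\<^sup>2 \<le> r k + \<beta> k" for k using infeasibility[of k] by simp
    show "(\<lambda>k. r k + \<beta> k) \<longlonglongrightarrow> 0" using tendsto_add[OF r_lim \<beta>_lim] by simp
  qed
  also have "(\<lambda>k. norm (infdist (x i0 k) Y)) = (\<lambda>k. norm (x i0 k - s k))"
    by (subst infdist_closest_point[OF Y]) (use y0(1) in \<open>auto simp: s_def\<close>)
  finally have feasible: "(\<lambda>k. x i0 k - s k) \<longlonglongrightarrow> 0"
    by (rule tendsto_norm_zero_cancel)
  have to_s: "(\<lambda>k. x a k - s k) \<longlonglongrightarrow> 0" if "a \<in> V" for a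
    using tendsto_add[OF consensus[OF that] feasible] by simp

  \<comment> \<open>Otherwise \<open>\<alpha> k\<close> would eventually be at most
    \<open>Suc n\<close> times the summable \<open>2 * \<alpha> k * e k\<close>.\<close>
  have "\<exists>k\<ge>n. e k < 1 / Suc n" for n
  proof (rule ccontr)
    assume contra: "\<not> ?thesis"
    have "summable \<alpha>"
    proof (rule summable_comparison_test_ev)
      show "summable (\<lambda>k. Suc n * (2 * \<alpha> k * e k))"
        by (rule summable_mult[OF \<alpha>e_sum])
      show "\<forall>\<^sub>F k in sequentially. norm (\<alpha> k) \<le> Suc n * (2 * \<alpha> k * e k)"
      proof (rule eventually_sequentiallyI)
        fix k assume "k \<ge> n"
        with contra have "1 / Suc n \<le> e k" by (auto simp: not_less)
        then have "1 \<le> Suc n * (2 * e k)" using e0[of k] by (simp add: field_simps)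
        from mult_left_mono[OF this, of "\<alpha> k"] \<alpha>(1)[of k]
        show "norm (\<alpha> k) \<le> Suc n * (2 * \<alpha> k * e k)" by (simp add: mult_ac)
      qed
    qed
    with \<alpha>(2) show False by simp
  qed
  then obtain \<sigma> where \<sigma>: "\<And>n. \<sigma> n \<ge> n" "\<And>n. e (\<sigma> n) < 1 / Suc n" by metis
  have "bounded (range (s \<circ> \<sigma>))"
  proof -
    obtain B where B: "\<And>k. norm (D y0 k) \<le> B"
      using convergent_imp_Bseq[OF D_conv[OF y0(1) refl]] by (auto simp: Bseq_def)
    have "norm (x i0 k - y0) \<le> sqrt B" for k
    proof -
      have "(norm (x i0 k - y0))\<^sup>2 \<le> D y0 k"
        unfolding D_def using member_le_sum[of i0 V "\<lambda>i. (norm (x i k - y0))\<^sup>2"] V by simp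
      also have "\<dots> \<le> B" using B[of k] by simp
      finally show ?thesis by (rule real_le_rsqrt)
    qed
    moreover obtain B' where "\<And>k. norm (x i0 k - s k) \<le> B'"
      using convergent_imp_Bseq[OF convergentI[OF feasible]] by (auto simp: Bseq_def)
    ultimately have "dist y0 (s k) \<le> sqrt B + B'" for k
      using dist_triangle[of y0 "s k" "x i0 k"] by (smt (verit) dist_norm dist_commute)
    then have "range (s \<circ> \<sigma>) \<subseteq> cball y0 (sqrt B + B')" by auto
    then show ?thesis using bounded_cball bounded_subset by blast
  qed
  then obtain y \<rho> where \<rho>: "strict_mono \<rho>" and lim: "((s \<circ> \<sigma>) \<circ> \<rho>) \<longlonglongrightarrow> y"
    using bounded_imp_convergent_subsequence[of "s \<circ> \<sigma>"] by auto
  \<comment> \<open>\<open>\<sigma>\<close> need not be monotone; \<open>\<sigma> n \<ge> n\<close>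
    together with \<open>\<rho>\<close> strictly increasing still makes \<open>\<tau>\<close> tend
    to infinity.\<close>
  define \<tau> where "\<tau> = \<sigma> \<circ> \<rho>"
  have \<tau>_ge: "\<tau> n \<ge> n" for n
    using \<sigma>(1)[of "\<rho> n"] seq_suble[OF \<rho>, of n] by (simp add: \<tau>_def)
  have \<tau>: "filterlim \<tau> sequentially sequentially"
    by (rule filterlim_at_top_mono[OF filterlim_ident]) (simp add: \<tau>_ge)
  have s_lim: "(\<lambda>n. s (\<tau> n)) \<longlonglongrightarrow> y" using lim by (simp add: \<tau>_def comp_def)
  have yY: "y \<in> Y" by (rule closed_sequentially[OF Y _ s_lim]) (simp add: s_in)
  have Fy: "F y = F y0"
  proof -
    have "(\<lambda>n. F (s (\<tau> n))) \<longlonglongrightarrow> F y"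
      by (rule continuous_on_tendsto_compose[OF F s_lim]) auto
    then have "(\<lambda>n. e (\<tau> n)) \<longlonglongrightarrow> F y - F y0" unfolding e_def by (intro tendsto_intros)
    moreover have "(\<lambda>n. e (\<tau> n)) \<longlonglongrightarrow> 0"
    proof (rule tendsto_sandwich[where f = "\<lambda>_. 0"])
      show "(\<lambda>n. 1 / real (Suc n)) \<longlonglongrightarrow> 0" using LIMSEQ_inverse_real_of_nat by (simp add: inverse_eq_divide)
      have "e (\<tau> n) \<le> 1 / Suc n" for n
      proof -
        have "e (\<tau> n) \<le> 1 / Suc (\<rho> n)" using \<sigma>(2)[of "\<rho> n"] by (simp add: \<tau>_def)
        also have "\<dots> \<le> 1 / Suc n" using seq_suble[OF \<rho>, of n] by (simp add: frac_le)
        finally show ?thesis .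
      qed
      then show "\<forall>\<^sub>F n in sequentially. e (\<tau> n) \<le> 1 / real (Suc n)" by simp
    qed (simp_all add: e0)
    ultimately show ?thesis using LIMSEQ_unique by fastforce
  qed
  obtain L where L: "D y \<longlonglongrightarrow> L" using D_conv[OF yY Fy] by (auto simp: convergent_def)
  \<comment> \<open>The limit is written with \<open>0 + y\<close> to match the decomposition of
    each iterate into a vanishing difference and \<open>s\<close>; its value is zero.\<close>
  have "(\<lambda>n. D y (\<tau> n)) \<longlonglongrightarrow> (\<Sum>i\<in>V. (norm (0 + y - y))\<^sup>2)"
    unfolding D_def
  proof (intro tendsto_intros)
    fix i assume "i \<in> V"
    have "(\<lambda>n. (x i (\<tau> n) - s (\<tau> n)) + s (\<tau> n)) \<longlonglongrightarrow> 0 + y"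
      by (rule tendsto_add[OF filterlim_compose[OF to_s[OF \<open>i \<in> V\<close>] \<tau>] s_lim])
    then show "(\<lambda>n. x i (\<tau> n)) \<longlonglongrightarrow> 0 + y" by simp
  qed
  then have "(\<lambda>n. D y (\<tau> n)) \<longlonglongrightarrow> 0" by simp
  moreover have "(\<lambda>n. D y (\<tau> n)) \<longlonglongrightarrow> L" by (rule filterlim_compose[OF L \<tau>])
  ultimately have "L = 0" using LIMSEQ_unique by blast
  have "x i \<longlonglongrightarrow> y" if i: "i \<in> V" for i
  proof -
    have "(\<lambda>k. (norm (x i k - y))\<^sup>2) \<longlonglongrightarrow> 0"
    proof (rule tendsto_sandwich[where f = "\<lambda>_. 0"])
      show "D y \<longlonglongrightarrow> 0" using L \<open>L = 0\<close> by simp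
      have "(norm (x i k - y))\<^sup>2 \<le> D y k" for k
        unfolding D_def using member_le_sum[of i V "\<lambda>i. (norm (x i k - y))\<^sup>2"] i V(1) by simp
      then show "\<forall>\<^sub>F k in sequentially. (norm (x i k - y))\<^sup>2 \<le> D y k" by simp
    qed auto
    from tendsto_real_sqrt[OF this] have "(\<lambda>k. norm (x i k - y)) \<longlonglongrightarrow> 0" by simp
    then show ?thesis by (rule tendsto_norm_zero_cancel[THEN LIM_zero_cancel])
  qed
  with yY Fy show ?thesis by blast
qed

section \<open>Independence of the past\<close>

text \<open>A generator, stable under intersections, of the sigma-algebra joining the initial points
  \<open>Y\<close> and the choices \<open>Z\<close> with index in \<open>K\<close>. It contains both
  families of events because each of them contains \<open>space P\<close>.\<close>

abbreviation past_generator ::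
    "'w measure \<Rightarrow> 'i set \<Rightarrow> ('i \<Rightarrow> 'b measure) \<Rightarrow> ('i \<Rightarrow> 'w \<Rightarrow> 'b) \<Rightarrow>
      'j set \<Rightarrow> ('j \<Rightarrow> 'c measure) \<Rightarrow> ('j \<Rightarrow> 'w \<Rightarrow> 'c) \<Rightarrow> 'w set set" where
  "past_generator P K N Z V N' Y \<equiv>
     {a \<inter> b | a b. a \<in> generated_events P V N' Y \<and> b \<in> generated_events P K N Z}"

lemma past_generatorI:
  "a \<in> generated_events P V N' Y \<Longrightarrow> b \<in> generated_events P K N Z \<Longrightarrow> a \<inter> b \<in> past_generator P K N Z V N' Y"
  by blast

lemma generated_events_eq:
  assumes "\<And>i. i \<in> J \<Longrightarrow> Y i \<in> measurable P (N i)"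
  shows "generated_events P J N Y = {(\<lambda>\<omega>. \<lambda>i\<in>J. Y i \<omega>) -` A \<inter> space P | A. A \<in> sets (Pi\<^sub>M J N)}"
  unfolding generated_events_def
  by (rule sets_vimage_algebra2) (use measurable_space[OF assms] in \<open>auto simp: space_PiM PiE_iff\<close>)

lemma component_in_generated_events:
  assumes meas: "\<And>i. i \<in> J \<Longrightarrow> Y i \<in> measurable P (N i)" and i: "i \<in> J" and A: "A \<in> sets (N i)"
  shows "Y i -` A \<inter> space P \<in> generated_events P J N Y"
proof -
  have "(\<lambda>f. f i) -` A \<inter> space (Pi\<^sub>M J N) \<in> sets (Pi\<^sub>M J N)"
    by (rule measurable_sets[OF measurable_component_singleton[OF i, of N] A])
  moreover have "Y i -` A \<inter> space P
      = (\<lambda>\<omega>. \<lambda>i\<in>J. Y i \<omega>) -` ((\<lambda>f. f i) -` A \<inter> space (Pi\<^sub>M J N)) \<inter> space P"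
    using i measurable_space[OF meas] by (auto simp: space_PiM PiE_iff)
  ultimately show ?thesis
    by (subst generated_events_eq[OF meas]) blast+
qed

text \<open>The map to the coordinates in \<open>K\<close> factors through the restriction map from
  the product over \<open>J\<close>.\<close>

lemma generated_events_mono:
  assumes meas: "\<And>i. i \<in> J \<Longrightarrow> Y i \<in> measurable P (N i)" and K: "K \<subseteq> J"
  shows "generated_events P K N Y \<subseteq> generated_events P J N Y"
proof
  have measK: "\<And>i. i \<in> K \<Longrightarrow> Y i \<in> measurable P (N i)" using meas K by auto
  fix b assume "b \<in> generated_events P K N Y"
  also have "generated_events P K N Y = {(\<lambda>\<omega>. \<lambda>i\<in>K. Y i \<omega>) -` A \<inter> space P | A. A \<in> sets (Pi\<^sub>M K N)}"
    by (rule generated_events_eq) (rule measK)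
  finally obtain A where A: "A \<in> sets (Pi\<^sub>M K N)" "b = (\<lambda>\<omega>. \<lambda>i\<in>K. Y i \<omega>) -` A \<inter> space P"
    by blast
  have "(\<lambda>f. restrict f K) -` A \<inter> space (Pi\<^sub>M J N) \<in> sets (Pi\<^sub>M J N)"
    by (rule measurable_sets[OF measurable_restrict_subset[OF K] A(1)])
  moreover have "b = (\<lambda>\<omega>. \<lambda>i\<in>J. Y i \<omega>) -` ((\<lambda>f. restrict f K) -` A \<inter> space (Pi\<^sub>M J N)) \<inter> space P"
    using measurable_space[OF meas] K by (auto simp: A space_PiM PiE_iff Int_absorb2 inf_commute[of _ K])
  ultimately show "b \<in> generated_events P J N Y"
    by (subst generated_events_eq[OF meas]) blast+
qed

lemma generated_events_Int:
  "a \<in> generated_events P J N Y \<Longrightarrow> b \<in> generated_events P J N Y \<Longrightarrow> a \<inter> b \<in> generated_events P J N Y"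
  unfolding generated_events_def by (rule sets.Int)

lemma space_in_generated_events: "space P \<in> generated_events P J N Y"
  unfolding generated_events_def by (metis sets.top space_vimage_algebra)

lemma generated_events_subset_Pow: "generated_events P J N Y \<subseteq> Pow (space P)"
  unfolding generated_events_def using sets.space_closed space_vimage_algebra by metis

lemma past_generator_subset_Pow: "past_generator P K N Z V N' Y \<subseteq> Pow (space P)"
  using generated_events_subset_Pow by blast

lemma
  assumes Z: "\<And>i. i \<in> K \<Longrightarrow> Z i \<in> measurable P (N i)" and Y: "\<And>i. i \<in> V \<Longrightarrow> Y i \<in> measurable P (N' i)"
  shows past_measurable: "i \<in> K \<Longrightarrow> Z i \<in> measurable (sigma (space P) (past_generator P K N Z V N' Y)) (N i)"
    and initial_measurable: "l \<in> V \<Longrightarrow> Y l \<in> measurable (sigma (space P) (past_generator P K N Z V N' Y)) (N' l)"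
proof -
  note sub = past_generator_subset_Pow[of P V N' Y K N Z]
  show "Z i \<in> measurable (sigma (space P) (past_generator P K N Z V N' Y)) (N i)" if "i \<in> K"
  proof (rule measurableI)
    fix A assume "A \<in> sets (N i)"
    then have "Z i -` A \<inter> space P \<in> generated_events P K N Z"
      using Z that by (intro component_in_generated_events) auto
    with space_in_generated_events
    have "space P \<inter> (Z i -` A \<inter> space P) \<in> past_generator P K N Z V N' Y"
      by (rule past_generatorI)
    then show "Z i -` A \<inter> space (sigma (space P) (past_generator P K N Z V N' Y))
        \<in> sets (sigma (space P) (past_generator P K N Z V N' Y))"
      using sub by (simp add: space_measure_of sets_measure_of Int_absorb1 sigma_sets.Basic)
  qed (use measurable_space[OF Z[OF that]] sub in \<open>simp add: space_measure_of\<close>)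
  show "Y l \<in> measurable (sigma (space P) (past_generator P K N Z V N' Y)) (N' l)" if "l \<in> V"
  proof (rule measurableI)
    fix A assume "A \<in> sets (N' l)"
    then have "Y l -` A \<inter> space P \<in> generated_events P V N' Y"
      using Y that by (intro component_in_generated_events) auto
    from this space_in_generated_events
    have "(Y l -` A \<inter> space P) \<inter> space P \<in> past_generator P K N Z V N' Y"
      by (rule past_generatorI)
    then show "Y l -` A \<inter> space (sigma (space P) (past_generator P K N Z V N' Y))
        \<in> sets (sigma (space P) (past_generator P K N Z V N' Y))"
      using sub by (simp add: space_measure_of sets_measure_of sigma_sets.Basic)
  qed (use measurable_space[OF Y[OF that]] sub in \<open>simp add: space_measure_of\<close>)
qed

section \<open>Fresh choices are independent of the past; expectations over a finite choice\<close>

context prob_space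
begin

text \<open>Independence is verified on two intersection-stable generators, the events of
  \<open>Z i\<close> and the intersections in \<open>past_generator\<close>, and extends to the
  generated sigma-algebras. The variable \<open>g\<close> stands for anything determined by the
  initial points and the choices indexed by \<open>K\<close>.\<close>

lemma indep_var_past:
  assumes Z: "indep_vars N Z J"
    and Y: "\<And>l. l \<in> V \<Longrightarrow> Y l \<in> measurable M (N' l)"
    and indep: "indep_set (generated_events M J N Z) (generated_events M V N' Y)"
    and i: "i \<in> J" "i \<notin> K" "K \<subseteq> J"
    and g: "g \<in> measurable (sigma (space M) (past_generator M K N Z V N' Y)) L"
    and h: "h \<in> measurable (N i) L"
  shows "indep_var L (\<lambda>\<omega>. h (Z i \<omega>)) L g"
proof -
  define G where "G = past_generator M K N Z V N' Y"
  have sub: "G \<subseteq> Pow (space M)" unfolding G_def by (rule past_generator_subset_Pow)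
  have measZ: "\<And>l. l \<in> J \<Longrightarrow> Z l \<in> measurable M (N l)"
    using Z unfolding indep_vars_def by auto
  have measK: "\<And>l. l \<in> K \<Longrightarrow> Z l \<in> measurable M (N l)" using measZ i by auto
  note evJ = indep_setD_ev1[OF indep] and evV = indep_setD_ev2[OF indep]
  have KJ: "generated_events M K N Z \<subseteq> generated_events M J N Z"
    using measZ i(3) by (rule generated_events_mono)
  let ?A = "{Z i -` A \<inter> space M | A. A \<in> sets (N i)}"
  have AJ: "?A \<subseteq> generated_events M J N Z"
    using component_in_generated_events[of J Z M N, OF _ i(1)] measZ by blast
  have GE: "G \<subseteq> events" unfolding G_def using KJ evJ evV by blast
  \<comment> \<open>All choices are jointly independent of the initial points, so \<open>a\<close>
    splits off from \<open>a0 \<inter> b\<close>. Then \<open>a0\<close> splits off from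
    \<open>b\<close>, since \<open>i\<close> is not in \<open>K\<close>, and \<open>a\<close> and
    \<open>b\<close> are joined again.\<close>
  have prod: "prob (a0 \<inter> (a \<inter> b)) = prob a0 * prob (a \<inter> b)"
    if a0: "a0 \<in> ?A" and a: "a \<in> generated_events M V N' Y" and b: "b \<in> generated_events M K N Z" for a0 a b
  proof -
    have iv: "indep_var (Pi\<^sub>M {i} N) (\<lambda>\<omega>. restrict (\<lambda>l. Z l \<omega>) {i}) (Pi\<^sub>M K N) (\<lambda>\<omega>. restrict (\<lambda>l. Z l \<omega>) K)"
      by (rule indep_var_restrict[OF Z]) (use i in auto)
    have "\<And>l. l \<in> {i} \<Longrightarrow> Z l \<in> measurable M (N l)" using measZ i(1) by auto
    note measi = this
    have "a0 \<in> generated_events M {i} N Z"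
      using a0 component_in_generated_events[of "{i}" Z M N i, OF measi] by blast
    also have "generated_events M {i} N Z = {(\<lambda>\<omega>. \<lambda>l\<in>{i}. Z l \<omega>) -` A \<inter> space M | A. A \<in> sets (Pi\<^sub>M {i} N)}"
      by (rule generated_events_eq) (rule measi)
    finally obtain A where A: "A \<in> sets (Pi\<^sub>M {i} N)" "a0 = (\<lambda>\<omega>. \<lambda>l\<in>{i}. Z l \<omega>) -` A \<inter> space M"
      by blast
    note b
    also have "generated_events M K N Z = {(\<lambda>\<omega>. \<lambda>l\<in>K. Z l \<omega>) -` A \<inter> space M | A. A \<in> sets (Pi\<^sub>M K N)}"
      by (rule generated_events_eq) (rule measK)
    finally obtain B where B: "B \<in> sets (Pi\<^sub>M K N)" "b = (\<lambda>\<omega>. \<lambda>l\<in>K. Z l \<omega>) -` B \<inter> space M"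
      by blast
    have ab: "prob (a0 \<inter> b) = prob a0 * prob b"
      using iv A B unfolding indep_var_eq by (auto intro!: indep_setD sigma_sets.Basic)
    have "prob ((a0 \<inter> b) \<inter> a) = prob (a0 \<inter> b) * prob a"
      using a0 a b AJ KJ by (intro indep_setD[OF indep] generated_events_Int) auto
    moreover have "prob (b \<inter> a) = prob b * prob a"
      using a b KJ by (intro indep_setD[OF indep]) auto
    moreover have "a0 \<inter> (a \<inter> b) = (a0 \<inter> b) \<inter> a" "a \<inter> b = b \<inter> a" by auto
    ultimately show ?thesis using ab by simp
  qed
  have "indep_set ?A G"
    unfolding indep_sets2_eq
  proof (intro conjI ballI)
    show "?A \<subseteq> events" using AJ evJ by (rule subset_trans)
    show "G \<subseteq> events" by (rule GE)
    fix a0 d assume a0: "a0 \<in> ?A" and "d \<in> G"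
    then obtain a b where "d = a \<inter> b" "a \<in> generated_events M V N' Y" "b \<in> generated_events M K N Z"
      unfolding G_def by blast
    then show "prob (a0 \<inter> d) = prob a0 * prob d" using prod[OF a0] by simp
  qed
  moreover have "Int_stable ?A"
  proof (rule Int_stableI)
    fix a b assume "a \<in> ?A" "b \<in> ?A"
    then obtain A B where AB: "A \<in> sets (N i)" "a = Z i -` A \<inter> space M" "B \<in> sets (N i)" "b = Z i -` B \<inter> space M"
      by (elim CollectE exE conjE) simp
    then have "A \<inter> B \<in> sets (N i)" "a \<inter> b = Z i -` (A \<inter> B) \<inter> space M" by auto
    then show "a \<inter> b \<in> ?A" by blast
  qed
  moreover have "Int_stable G"
  proof (rule Int_stableI)
    fix a b assume "a \<in> G" "b \<in> G"
    then obtain a1 a2 b1 b2 where *: "a = a1 \<inter> a2" "b = b1 \<inter> b2"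
        "a1 \<in> generated_events M V N' Y" "a2 \<in> generated_events M K N Z"
        "b1 \<in> generated_events M V N' Y" "b2 \<in> generated_events M K N Z"
      unfolding G_def by blast
    have "a1 \<inter> b1 \<in> generated_events M V N' Y" "a2 \<inter> b2 \<in> generated_events M K N Z"
      using * by (auto intro: generated_events_Int)
    moreover have "a \<inter> b = (a1 \<inter> b1) \<inter> (a2 \<inter> b2)" using * by auto
    ultimately show "a \<inter> b \<in> G" unfolding G_def by (simp only: past_generatorI)
  qed
  ultimately have "indep_set (sigma_sets (space M) ?A) (sigma_sets (space M) G)"
    by (rule indep_set_sigma_sets)
  moreover have gG: "{g -` B \<inter> space M | B. B \<in> sets L} \<subseteq> sigma_sets (space M) G"
    using measurable_sets[OF g] sub by (auto simp: G_def[symmetric] space_measure_of sets_measure_of)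
  then have "sigma_sets (space M) {g -` B \<inter> space M | B. B \<in> sets L} \<subseteq> sigma_sets (space M) G"
    by (rule sigma_sets_mono)
  moreover have "random_variable L g"
  proof (rule measurable_mono[THEN subsetD, OF _ _ _ _ g])
    show "sets (sigma (space M) (past_generator M K N Z V N' Y)) \<subseteq> events"
      using sub GE by (simp add: G_def[symmetric] sets_measure_of sets.sigma_sets_subset)
  qed (use sub in \<open>auto simp: G_def space_measure_of\<close>)
  moreover have "sigma_sets (space M) {(\<lambda>\<omega>. h (Z i \<omega>)) -` B \<inter> space M | B. B \<in> sets L} \<subseteq> sigma_sets (space M) ?A"
  proof (rule sigma_sets_mono', clarify)
    fix B assume "B \<in> sets L"
    then have "h -` B \<inter> space (N i) \<in> sets (N i)" by (rule measurable_sets[OF h])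
    moreover have "(\<lambda>\<omega>. h (Z i \<omega>)) -` B \<inter> space M = Z i -` (h -` B \<inter> space (N i)) \<inter> space M"
      using measZ[OF i(1)] by (auto simp: measurable_space)
    ultimately show "\<exists>A. (\<lambda>\<omega>. h (Z i \<omega>)) -` B \<inter> space M = Z i -` A \<inter> space M \<and> A \<in> sets (N i)"
      by blast
  qed
  moreover have "random_variable L (\<lambda>\<omega>. h (Z i \<omega>))"
    using measZ[OF i(1)] h by (rule measurable_compose)
  ultimately show ?thesis
    unfolding indep_var_eq indep_sets2_eq by blast
qed

lemma
  assumes Z: "Z \<in> measurable M (count_space I)" and j: "j \<in> I"
  shows integrable_indicator_eq: "integrable M (\<lambda>\<omega>. indicator {j} (Z \<omega>) :: real)"
    and expectation_indicator_eq: "expectation (\<lambda>\<omega>. indicator {j} (Z \<omega>) :: real) = prob {\<omega>\<in>space M. Z \<omega> = j}"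
proof -
  have ev: "{\<omega>\<in>space M. Z \<omega> = j} \<in> events"
    using measurable_sets[OF Z, of "{j}"] j by (simp add: vimage_def Int_def conj_commute)
  have eq: "(indicator {j} (Z \<omega>) :: real) = indicator {\<omega>\<in>space M. Z \<omega> = j} \<omega>" if "\<omega> \<in> space M" for \<omega>
    using that by (simp add: indicator_def)
  show "integrable M (\<lambda>\<omega>. indicator {j} (Z \<omega>) :: real)"
    by (subst Bochner_Integration.integrable_cong[OF refl eq])
       (use ev in \<open>auto intro!: integrable_real_indicator simp: emeasure_eq_measure\<close>)
  show "expectation (\<lambda>\<omega>. indicator {j} (Z \<omega>) :: real) = prob {\<omega>\<in>space M. Z \<omega> = j}"
    by (subst Bochner_Integration.integral_cong[OF refl eq]) (use ev in simp_all)
qed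

lemma finite_choice_eq_sum:
  fixes g :: "'b \<Rightarrow> 'c \<Rightarrow> real"
  assumes "finite I" "b \<in> I"
  shows "g b \<omega> = (\<Sum>j\<in>I. indicator {j} b * g j \<omega>)"
  using assms by (simp add: indicator_def if_distrib[of "\<lambda>x. x * _"] cong: if_cong)

text \<open>Freezing a finite choice: after splitting by the value \<open>j\<close> of
  \<open>Z\<close>, the indicator is independent of \<open>g j\<close> and the expectation of the
  product factors. This replaces conditional expectation.\<close>

lemma expectation_finite_choice:
  fixes g :: "'b \<Rightarrow> 'a \<Rightarrow> real"
  assumes I: "finite I" and Z: "Z \<in> measurable M (count_space I)"
    and g: "\<And>j. j \<in> I \<Longrightarrow> integrable M (g j)"
    and ind: "\<And>j. j \<in> I \<Longrightarrow> indep_var borel (\<lambda>\<omega>. indicator {j} (Z \<omega>)) borel (g j)"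
  shows "integrable M (\<lambda>\<omega>. g (Z \<omega>) \<omega>)"
    and "expectation (\<lambda>\<omega>. g (Z \<omega>) \<omega>) = (\<Sum>j\<in>I. prob {\<omega>\<in>space M. Z \<omega> = j} * expectation (g j))"
proof -
  have split: "g (Z \<omega>) \<omega> = (\<Sum>j\<in>I. indicator {j} (Z \<omega>) * g j \<omega>)" if "\<omega> \<in> space M" for \<omega>
    using measurable_space[OF Z that] by (intro finite_choice_eq_sum I) simp
  have int2: "integrable M (\<lambda>\<omega>. indicator {j} (Z \<omega>) * g j \<omega>)" if "j \<in> I" for j
    by (rule indep_var_integrable[OF ind integrable_indicator_eq[OF Z] g]) (fact that)+
  show "integrable M (\<lambda>\<omega>. g (Z \<omega>) \<omega>)"
    by (subst Bochner_Integration.integrable_cong[OF refl split]) (use int2 in simp_all)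
  have "expectation (\<lambda>\<omega>. g (Z \<omega>) \<omega>) = (\<Sum>j\<in>I. expectation (\<lambda>\<omega>. indicator {j} (Z \<omega>) * g j \<omega>))"
    by (subst Bochner_Integration.integral_cong[OF refl split]) (use int2 in simp_all)
  also have "\<dots> = (\<Sum>j\<in>I. prob {\<omega>\<in>space M. Z \<omega> = j} * expectation (g j))"
    by (intro sum.cong refl)
       (simp add: indep_var_lebesgue_integral[OF ind integrable_indicator_eq[OF Z] g] expectation_indicator_eq[OF Z])
  finally show "expectation (\<lambda>\<omega>. g (Z \<omega>) \<omega>) = (\<Sum>j\<in>I. prob {\<omega>\<in>space M. Z \<omega> = j} * expectation (g j))" .
qed

lemma expectation_finite_valued:
  fixes h :: "'b \<Rightarrow> real"
  assumes I: "finite I" and Z: "Z \<in> measurable M (count_space I)"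
  shows "expectation (\<lambda>\<omega>. h (Z \<omega>)) = (\<Sum>j\<in>I. prob {\<omega>\<in>space M. Z \<omega> = j} * h j)"
proof -
  have split: "h (Z \<omega>) = (\<Sum>j\<in>I. indicator {j} (Z \<omega>) * h j)" if "\<omega> \<in> space M" for \<omega>
    using measurable_space[OF Z that] finite_choice_eq_sum[OF I, of "Z \<omega>" "\<lambda>j _. h j"] by simp
  show ?thesis
    by (subst Bochner_Integration.integral_cong[OF refl split])
       (simp_all add: integrable_indicator_eq[OF Z] expectation_indicator_eq[OF Z])
qed

text \<open>By monotone convergence the expected total is finite, so the total is finite almost
  surely.\<close>

lemma AE_summable:
  fixes g :: "nat \<Rightarrow> 'a \<Rightarrow> real"
  assumes g: "\<And>k. integrable M (g k)" "\<And>k \<omega>. \<omega> \<in> space M \<Longrightarrow> g k \<omega> \<ge> 0"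
    and sum: "summable (\<lambda>k. expectation (g k))"
  shows "AE \<omega> in M. summable (\<lambda>k. g k \<omega>)"
proof -
  have "(\<integral>\<^sup>+\<omega>. (\<Sum>k. ennreal (g k \<omega>)) \<partial>M) = (\<Sum>k. \<integral>\<^sup>+\<omega>. ennreal (g k \<omega>) \<partial>M)"
    using g by (intro nn_integral_suminf) auto
  also have "\<dots> = (\<Sum>k. ennreal (expectation (g k)))"
    using g by (intro suminf_cong nn_integral_eq_integral) auto
  also have "\<dots> \<noteq> \<infinity>"
    using sum g by (subst suminf_ennreal2) (auto intro: integral_nonneg_AE)
  finally have "AE \<omega> in M. (\<Sum>k. ennreal (g k \<omega>)) \<noteq> \<infinity>"
    using g by (intro nn_integral_PInf_AE) auto
  with AE_space show ?thesis
  proof eventually_elim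
    case (elim \<omega>)
    then show ?case using g(2) by (intro summable_suminf_not_top) auto
  qed
qed

end

section \<open>The network algorithm along one path\<close>

text \<open>Only deterministic data. The graphs enter solely through \<open>spread\<close>, which is
  uniform in time and has the form that strong connectivity and the lower bound on the weights
  provide.\<close>

locale prox_network =
  fixes V :: "'i set" and i0 :: 'i and f :: "'i \<Rightarrow> 'a::euclidean_space \<Rightarrow> real" and Y :: "'a set"
    and W :: "'i \<Rightarrow> 'i \<Rightarrow> nat \<Rightarrow> real" and \<alpha> :: "nat \<Rightarrow> real" and M c \<kappa> :: real
  assumes V: "finite V" "i0 \<in> V"
    and convex: "\<And>i. i \<in> V \<Longrightarrow> convex_on UNIV (f i)"
    and M: "\<And>i p g. i \<in> V \<Longrightarrow> p \<in> Y \<Longrightarrow> g \<in> subdifferential (f i) p \<Longrightarrow> norm g \<le> M" "M \<ge> 0"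
    and closed_Y: "closed Y"
    and \<alpha>: "\<And>k. \<alpha> k > 0" "\<not> summable \<alpha>" "summable (\<lambda>k. (\<alpha> k)\<^sup>2)"
    and c: "c > 0" and \<kappa>: "\<kappa> > 0"
    and W: "\<And>i j k. i \<in> V \<Longrightarrow> j \<in> V \<Longrightarrow> W i j k \<ge> 0"
      "\<And>i k. i \<in> V \<Longrightarrow> (\<Sum>j\<in>V. W i j k) = 1" "\<And>j k. j \<in> V \<Longrightarrow> (\<Sum>i\<in>V. W i j k) = 1"
    and spread: "\<And>k (x :: 'i \<Rightarrow> 'a) v a b. a \<in> V \<Longrightarrow> b \<in> V \<Longrightarrow>
      \<kappa> * (norm (x a - x b))\<^sup>2 \<le> (\<Sum>i\<in>V. \<Sum>j\<in>V. W i j k * (norm (x j - v i))\<^sup>2)"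
begin

abbreviation total :: "'a \<Rightarrow> real" where
  "total p \<equiv> \<Sum>i\<in>V. f i p"

definition mix :: "nat \<Rightarrow> ('i \<Rightarrow> 'a) \<Rightarrow> 'i \<Rightarrow> 'a" where
  "mix k x i = (\<Sum>j\<in>V. W i j k *\<^sub>R x j)"

definition half_step :: "nat \<Rightarrow> ('i \<Rightarrow> 'a) \<Rightarrow> 'i \<Rightarrow> 'a" where
  "half_step k x i = prox (\<lambda>y. \<alpha> k * f i y) (mix k x i)"

definition variance_drop :: "nat \<Rightarrow> ('i \<Rightarrow> 'a) \<Rightarrow> real" where
  "variance_drop k x = (\<Sum>i\<in>V. \<Sum>j\<in>V. W i j k * (norm (x j - mix k x i))\<^sup>2)"

text \<open>The part of the gains of averaging and of the proximal step that is left after Young's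
  inequality has taken its halves.\<close>

definition gap :: "nat \<Rightarrow> ('i \<Rightarrow> 'a) \<Rightarrow> real" where
  "gap k x = variance_drop k x / 2 + (\<Sum>i\<in>V. (norm (mix k x i - half_step k x i))\<^sup>2) / 2"

text \<open>Measured before the projection, because these points do not depend on the random sets
  chosen at time \<open>k\<close>.\<close>

definition infeasibility :: "nat \<Rightarrow> ('i \<Rightarrow> 'a) \<Rightarrow> real" where
  "infeasibility k x = (\<Sum>i\<in>V. (infdist (half_step k x i) Y)\<^sup>2)"

definition K :: real where
  "K = card V * (8 + 8 * card V / \<kappa> + 2 * c) * M\<^sup>2"

lemma K_nonneg: "K \<ge> 0"
  using c \<kappa> by (simp add: K_def)

lemma convex_scaled: "i \<in> V \<Longrightarrow> convex_on UNIV (\<lambda>y. \<alpha> k * f i y)"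
  using convex \<alpha>(1) by (intro convex_on_cmul) (auto intro: less_imp_le)

lemma descent_step:
  assumes "y \<in> Y" and "\<And>i. i \<in> V \<Longrightarrow> closed (S i) \<and> convex (S i) \<and> Y \<subseteq> S i"
    and "\<And>i. i \<in> V \<Longrightarrow> x' i = closest_point (S i) (half_step k x i)"
  shows "(\<Sum>i\<in>V. (norm (x' i - y))\<^sup>2) + gap k x + (\<Sum>i\<in>V. (infdist (half_step k x i) (S i))\<^sup>2)
      + 2 * \<alpha> k * ((\<Sum>i\<in>V. f i (closest_point Y (x i0))) - (\<Sum>i\<in>V. f i y))
    \<le> (\<Sum>i\<in>V. (norm (x i - y))\<^sup>2) + infeasibility k x / (2 * c) + K * (\<alpha> k)\<^sup>2"
proof -
  have "(\<Sum>i\<in>V. (norm (x' i - y))\<^sup>2) + variance_drop k x / 2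
      + (\<Sum>i\<in>V. (norm (mix k x i - half_step k x i))\<^sup>2) / 2
      + (\<Sum>i\<in>V. (infdist (half_step k x i) (S i))\<^sup>2)
      + 2 * \<alpha> k * ((\<Sum>i\<in>V. f i (closest_point Y (x i0))) - (\<Sum>i\<in>V. f i y))
    \<le> (\<Sum>i\<in>V. (norm (x i - y))\<^sup>2) + (\<Sum>i\<in>V. (infdist (half_step k x i) Y)\<^sup>2) / (2 * c)
      + card V * (8 + 8 * card V / \<kappa> + 2 * c) * M\<^sup>2 * (\<alpha> k)\<^sup>2"
    by (rule distributed_step[where W = "\<lambda>i j. W i j k" and f = f])
       (use V convex \<alpha>(1) M closed_Y assms c \<kappa> W spread in
         \<open>simp_all add: mix_def half_step_def variance_drop_def\<close>)
  then show ?thesis by (simp add: gap_def infeasibility_def K_def)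
qed

lemma variance_drop_nonneg: "variance_drop k x \<ge> 0"
  unfolding variance_drop_def by (intro sum_nonneg mult_nonneg_nonneg W) auto

lemma gap_nonneg: "gap k x \<ge> 0"
  unfolding gap_def using variance_drop_nonneg by (simp add: sum_nonneg)

lemma infeasibility_nonneg: "infeasibility k x \<ge> 0"
  unfolding infeasibility_def by (simp add: sum_nonneg)

lemma variance_drop_le_gap: "variance_drop k x \<le> 2 * gap k x"
  unfolding gap_def by (simp add: sum_nonneg)

text \<open>Infeasibility is known at the half step only; the way from \<open>x i0\<close> leads
  through its average and its half step to \<open>Y\<close>. The factor 3 comes from squaring a sum
  of three terms.\<close>

lemma infdist_reference_le:
  "(infdist (x i0) Y)\<^sup>2 \<le> 3 * (2 / \<kappa> + 2) * gap k x + 3 * infeasibility k x"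
proof -
  let ?v = "mix k x i0" and ?z = "half_step k x i0"
  have "infdist (x i0) Y \<le> infdist ?z Y + norm (x i0 - ?z)"
    using infdist_triangle[of "x i0" Y ?z] by (simp add: dist_norm)
  also have "norm (x i0 - ?z) \<le> norm (?v - x i0) + norm (?v - ?z)" by norm
  finally have "(infdist (x i0) Y)\<^sup>2 \<le> (infdist ?z Y + (norm (?v - x i0) + norm (?v - ?z)))\<^sup>2"
    by (intro power_mono) (auto simp: infdist_nonneg)
  also have "\<dots> \<le> 3 * ((infdist ?z Y)\<^sup>2 + (norm (?v - x i0))\<^sup>2 + (norm (?v - ?z))\<^sup>2)"
    using sum_squares_bound[of "infdist ?z Y" "norm (?v - x i0)"]
      sum_squares_bound[of "infdist ?z Y" "norm (?v - ?z)"]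
      sum_squares_bound[of "norm (?v - x i0)" "norm (?v - ?z)"]
    by (simp add: power2_sum algebra_simps)
  finally have *: "(infdist (x i0) Y)\<^sup>2 \<le> 3 * ((infdist ?z Y)\<^sup>2 + (norm (?v - x i0))\<^sup>2 + (norm (?v - ?z))\<^sup>2)" .
  have "(infdist ?z Y)\<^sup>2 \<le> infeasibility k x"
    unfolding infeasibility_def using V by (intro member_le_sum) auto
  moreover have "(norm (?v - ?z))\<^sup>2 \<le> 2 * gap k x"
    using member_le_sum[of i0 V "\<lambda>i. (norm (mix k x i - half_step k x i))\<^sup>2"] V variance_drop_nonneg[of k x]
    by (simp add: gap_def)
  moreover have "\<kappa> * (norm (?v - x i0))\<^sup>2 \<le> 2 * gap k x"
  proof -
    have "\<kappa> * (norm (?v - x i0))\<^sup>2 \<le> variance_drop k x"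
      unfolding mix_def[of k x i0] variance_drop_def
      using V W \<kappa> spread by (intro average_spread) auto
    then show ?thesis using variance_drop_le_gap by (rule order_trans)
  qed
  then have "(norm (?v - x i0))\<^sup>2 \<le> 2 / \<kappa> * gap k x"
    using \<kappa> by (simp add: field_simps)
  ultimately show ?thesis using * by (simp add: algebra_simps)
qed

text \<open>Once infeasibility is summable along a path, the term that only an expectation could
  absorb is a summable error, and the quasi-Fejer argument applies to this path.\<close>

lemma run_convergence:
  fixes x :: "'i \<Rightarrow> nat \<Rightarrow> 'a"
  assumes y0: "y0 \<in> Y" "\<And>p. p \<in> Y \<Longrightarrow> total y0 \<le> total p"
    and S: "\<And>i k. i \<in> V \<Longrightarrow> closed (S i k) \<and> convex (S i k) \<and> Y \<subseteq> S i k"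
    and run: "\<And>i k. i \<in> V \<Longrightarrow> x i (Suc k) = closest_point (S i k) (half_step k (\<lambda>j. x j k) i)"
    and feasible: "summable (\<lambda>k. infeasibility k (\<lambda>j. x j k))"
  shows "\<exists>y\<in>Y. total y = total y0 \<and> (\<forall>i\<in>V. x i \<longlonglongrightarrow> y)"
proof -
  define g where "g k = gap k (\<lambda>j. x j k)" for k
  define d where "d k = infeasibility k (\<lambda>j. x j k)" for k
  define \<beta> where "\<beta> k = d k / (2 * c) + K * (\<alpha> k)\<^sup>2" for k
  \<comment> \<open>\<open>L\<close> dominates \<open>2 / \<kappa>\<close> for the disagreement,
    \<open>3 * (2 / \<kappa> + 2)\<close> for the gap, and \<open>6 * c\<close>, which rewrites
    \<open>3 * d k\<close> as a multiple of \<open>d k / (2 * c)\<close>.\<close>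
  define L where "L = 6 / \<kappa> + 6 + 6 * c"
  have "2 / \<kappa> \<le> 6 / \<kappa>" using \<kappa> by (intro divide_right_mono) auto
  then have L: "L > 0" "2 / \<kappa> \<le> L" using c \<kappa> by (auto simp: L_def add_pos_pos)
  have g0: "g k \<ge> 0" and d0: "d k \<ge> 0" for k
    by (simp_all add: g_def d_def gap_nonneg infeasibility_nonneg)
  show ?thesis
  proof (rule quasi_Fejer_convergence[where r = g and \<beta> = \<beta> and \<alpha> = \<alpha> and \<kappa> = "1 / L"])
    show "continuous_on UNIV total"
      by (intro continuous_on_sum convex_on_continuous open_UNIV convex)
    show "summable \<beta>"
      unfolding \<beta>_def d_def using feasible \<alpha>(3) by (intro summable_add summable_divide summable_mult)
    show "\<beta> k \<ge> 0" for k using d0[of k] c K_nonneg by (simp add: \<beta>_def)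
    show "(\<Sum>i\<in>V. (norm (x i (Suc k) - y))\<^sup>2) + g k
        + 2 * \<alpha> k * (total (closest_point Y (x i0 k)) - total y)
      \<le> (\<Sum>i\<in>V. (norm (x i k - y))\<^sup>2) + \<beta> k" if "y \<in> Y" for y k
    proof -
      have "(\<Sum>i\<in>V. (infdist (half_step k (\<lambda>j. x j k) i) (S i k))\<^sup>2) \<ge> 0" by (simp add: sum_nonneg)
      then show ?thesis
        using descent_step[OF that, of "\<lambda>i. S i k" "\<lambda>i. x i (Suc k)" k "\<lambda>j. x j k"] S run
        by (simp add: \<beta>_def g_def d_def)
    qed
    show "1 / L * (norm (x a k - x i0 k))\<^sup>2 \<le> g k" if "a \<in> V" for a k
    proof -
      have "\<kappa> * (norm (x a k - x i0 k))\<^sup>2 \<le> variance_drop k (\<lambda>j. x j k)"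
        unfolding variance_drop_def by (rule spread[of a i0 "\<lambda>j. x j k"]) (use that V in auto)
      also have "\<dots> \<le> 2 * g k" unfolding g_def by (rule variance_drop_le_gap)
      finally have "(norm (x a k - x i0 k))\<^sup>2 \<le> 2 / \<kappa> * g k"
        using \<kappa> by (simp add: field_simps)
      also have "\<dots> \<le> L * g k"
        using L(2) \<kappa> g0[of k] by (intro mult_right_mono) auto
      finally show ?thesis using L(1) by (simp add: field_simps)
    qed
    show "1 / L * (infdist (x i0 k) Y)\<^sup>2 \<le> g k + \<beta> k" for k
    proof -
      have "(infdist (x i0 k) Y)\<^sup>2 \<le> 3 * (2 / \<kappa> + 2) * g k + 3 * d k"
        unfolding g_def d_def by (rule infdist_reference_le)
      also have "\<dots> \<le> L * g k + L * (d k / (2 * c))"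
      proof (rule add_mono)
        show "3 * (2 / \<kappa> + 2) * g k \<le> L * g k"
          using c g0[of k] by (intro mult_right_mono) (auto simp: L_def)
        have "3 * d k = (6 * c) * (d k / (2 * c))" using c by simp
        also have "\<dots> \<le> L * (d k / (2 * c))"
          using c \<kappa> d0[of k] by (intro mult_right_mono) (auto simp: L_def)
        finally show "3 * d k \<le> L * (d k / (2 * c))" .
      qed
      also have "\<dots> \<le> L * (g k + \<beta> k)"
        using L(1) K_nonneg by (simp add: \<beta>_def distrib_left)
      finally show ?thesis using L(1) by (simp add: field_simps)
    qed
  qed (use V closed_Y y0 g0 \<alpha> L in auto)
qed

end

section \<open>The random algorithm\<close>

locale random_prox_network = prox_network V i0 f Y W \<alpha> M c \<kappa> + prob_space P
  for V :: "'i set" and i0 and f :: "'i \<Rightarrow> 'a::euclidean_space \<Rightarrow> real" and Y W \<alpha> M c \<kappa>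
    and P :: "'w measure" +
  fixes I :: "'i \<Rightarrow> 'b set" and X :: "'i \<Rightarrow> 'b \<Rightarrow> 'a set" and \<Omega> :: "'i \<Rightarrow> nat \<Rightarrow> 'w \<Rightarrow> 'b"
    and x :: "'i \<Rightarrow> nat \<Rightarrow> 'w \<Rightarrow> 'a" and y0 :: 'a
  assumes y0: "y0 \<in> Y" "\<And>p. p \<in> Y \<Longrightarrow> total y0 \<le> total p"
    and I: "\<And>i. i \<in> V \<Longrightarrow> finite (I i)"
    and X: "\<And>i j. i \<in> V \<Longrightarrow> j \<in> I i \<Longrightarrow> closed (X i j) \<and> convex (X i j) \<and> Y \<subseteq> X i j"
    and initial: "\<And>i. i \<in> V \<Longrightarrow> x i 0 \<in> borel_measurable P"
    and indep: "indep_vars (\<lambda>(i, k). count_space (I i)) (\<lambda>(i, k). \<Omega> i k) (V \<times> UNIV)"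
    and indep_initial: "indep_set
          (generated_events P (V \<times> UNIV) (\<lambda>(i, k). count_space (I i)) (\<lambda>(i, k). \<Omega> i k))
          (generated_events P V (\<lambda>_. borel) (\<lambda>i. x i 0))"
    and regularity: "\<And>i y k. i \<in> V \<Longrightarrow>
          (infdist y Y)\<^sup>2 \<le> c * expectation (\<lambda>\<omega>. (infdist y (X i (\<Omega> i k \<omega>)))\<^sup>2)"
    and algorithm: "\<And>\<omega> k i. \<omega> \<in> space P \<Longrightarrow> i \<in> V \<Longrightarrow>
          x i (Suc k) \<omega> = closest_point (X i (\<Omega> i k \<omega>)) (half_step k (\<lambda>j. x j k \<omega>) i)"
begin

section \<open>Measurability and boundedness of the random iterates\<close>

abbreviation iterate :: "nat \<Rightarrow> 'w \<Rightarrow> 'i \<Rightarrow> 'a" where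
  "iterate k \<omega> \<equiv> \<lambda>j. x j k \<omega>"

lemma \<Omega>_measurable:
  assumes "i \<in> V"
  shows "\<Omega> i k \<in> measurable P (count_space (I i))"
proof -
  have "(i, k) \<in> V \<times> UNIV" using assms by simp
  with indep have "(case (i, k) of (i, k) \<Rightarrow> \<Omega> i k)
      \<in> measurable P (case (i, k) of (i, k) \<Rightarrow> count_space (I i))"
    unfolding indep_vars_def by blast
  then show ?thesis by simp
qed

lemma \<Omega>_in: "i \<in> V \<Longrightarrow> \<omega> \<in> space P \<Longrightarrow> \<Omega> i k \<omega> \<in> I i"
  using measurable_space[OF \<Omega>_measurable, of i \<omega> k] by simp

lemma chosen_set: "i \<in> V \<Longrightarrow> \<omega> \<in> space P \<Longrightarrow>
    closed (X i (\<Omega> i k \<omega>)) \<and> convex (X i (\<Omega> i k \<omega>)) \<and> Y \<subseteq> X i (\<Omega> i k \<omega>)"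
  using X \<Omega>_in by blast

lemma half_measurable:
  assumes u: "\<And>j. j \<in> V \<Longrightarrow> u j \<in> borel_measurable N" and i: "i \<in> V"
  shows "(\<lambda>\<omega>. half_step k (\<lambda>j. u j \<omega>) i) \<in> borel_measurable N"
proof -
  have "(\<lambda>\<omega>. mix k (\<lambda>j. u j \<omega>) i) \<in> borel_measurable N"
    unfolding mix_def using u by (intro borel_measurable_sum borel_measurable_scaleR) auto
  moreover have "prox (\<lambda>y. \<alpha> k * f i y) \<in> borel_measurable borel"
    by (intro borel_measurable_continuous_onI continuous_on_prox convex_scaled i)
  ultimately show ?thesis
    unfolding half_step_def by (rule measurable_compose)
qed

text \<open>The iterate at time \<open>k\<close> is built from the initial points and the choices
  before \<open>k\<close>. The measure \<open>N\<close> is left general so that the result holds for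
  the sigma-algebra of the past as well as for \<open>P\<close>.\<close>

lemma iterate_measurable:
  assumes N: "space N = space P" "\<And>i. i \<in> V \<Longrightarrow> x i 0 \<in> borel_measurable N"
      "\<And>i l. i \<in> V \<Longrightarrow> l < n \<Longrightarrow> \<Omega> i l \<in> measurable N (count_space (I i))"
    and "k \<le> n" "i \<in> V"
  shows "x i k \<in> borel_measurable N"
  using assms(4,5)
proof (induction k arbitrary: i)
  case (Suc k)
  \<comment> \<open>For a fixed index the projection is continuous, and the random index takes
    countably many values.\<close>
  have "(\<lambda>\<omega>. closest_point (X i (\<Omega> i k \<omega>)) (half_step k (iterate k \<omega>) i)) \<in> borel_measurable N"
  proof (rule measurable_compose_countable'[where g = "\<Omega> i k" and I = "I i"
          and f = "\<lambda>j \<omega>. closest_point (X i j) (half_step k (iterate k \<omega>) i)"])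
    show "\<Omega> i k \<in> measurable N (count_space (I i))" using N(3) Suc.prems by simp
    show "countable (I i)" using I Suc.prems by (simp add: countable_finite)
    fix j assume j: "j \<in> I i"
    have "closest_point (X i j) \<in> borel_measurable borel"
      using X[OF Suc.prems(2) j] y0(1)
      by (intro borel_measurable_continuous_onI continuous_on_closest_point) auto
    then show "(\<lambda>\<omega>. closest_point (X i j) (half_step k (iterate k \<omega>) i)) \<in> borel_measurable N"
      by (rule measurable_compose[rotated]) (use Suc in \<open>auto intro: half_measurable\<close>)
  qed
  then show ?case
    by (rule measurable_cong[THEN iffD2, rotated]) (use N(1) algorithm Suc.prems in auto)
qed (use N in auto)

lemma iterate_borel: "i \<in> V \<Longrightarrow> x i k \<in> borel_measurable P"
  using iterate_measurable[of P k k i] initial \<Omega>_measurable by auto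

text \<open>A convex combination stays in the ball around \<open>y\<close> and \<open>prox\<close>
  is nonexpansive, so the only growth is the displacement of \<open>y\<close> itself by
  \<open>prox\<close>, which is the same on all paths.\<close>

lemma norm_half_le:
  assumes u: "\<And>j. j \<in> V \<Longrightarrow> norm (u j - y) \<le> B" and B: "B \<ge> 0" and i: "i \<in> V"
  shows "norm (half_step k u i - y) \<le> B + (\<Sum>i\<in>V. norm (prox (\<lambda>y. \<alpha> k * f i y) y - y))"
proof -
  let ?p = "\<lambda>i. prox (\<lambda>y. \<alpha> k * f i y)"
  have "1 * (norm (mix k u i - y))\<^sup>2 \<le> B\<^sup>2"
    unfolding mix_def using W i u by (intro average_spread) (auto intro: power_mono)
  then have mix: "norm (mix k u i - y) \<le> B" using B by (auto intro: power2_le_imp_le)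
  have "norm (half_step k u i - y) \<le> norm (?p i (mix k u i) - ?p i y) + norm (?p i y - y)"
    using dist_triangle[of "?p i (mix k u i)" y "?p i y"] by (simp add: half_step_def dist_norm)
  also have "norm (?p i (mix k u i) - ?p i y) \<le> norm (mix k u i - y)"
    by (intro prox_nonexpansive convex_scaled i)
  also have "norm (?p i y - y) \<le> (\<Sum>i\<in>V. norm (?p i y - y))"
    using i V(1) by (intro member_le_sum) auto
  finally show ?thesis using mix by simp
qed

text \<open>Localization that makes all expectations finite without any moment of the initial
  points. It depends on the initial points alone, so it belongs to the past at every time.\<close>

definition start_ball :: "real \<Rightarrow> 'w set" where
  "start_ball R = {\<omega>\<in>space P. \<forall>i\<in>V. norm (x i 0 \<omega>) \<le> R}"

lemma start_ball_sets:
  assumes "space N = space P" "\<And>i. i \<in> V \<Longrightarrow> x i 0 \<in> borel_measurable N"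
  shows "start_ball R \<in> sets N"
  unfolding start_ball_def assms(1)[symmetric]
proof (rule sets.sets_Collect_finite_All)
  fix i assume "i \<in> V"
  have "(\<lambda>\<omega>. norm (x i 0 \<omega>)) \<in> borel_measurable N" using assms(2)[OF \<open>i \<in> V\<close>] by measurable
  then show "{\<omega> \<in> space N. norm (x i 0 \<omega>) \<le> R} \<in> sets N"
    using borel_measurable_le[OF _ borel_measurable_const] by blast
qed (use V in auto)

text \<open>The point \<open>y0\<close> lies in every chosen set, so the projection does not
  increase the distance to it. The bound may grow with \<open>k\<close>, as it serves only for
  integrability at each time.\<close>

lemma iterate_bounded:
  "\<exists>B\<ge>0. \<forall>\<omega>\<in>start_ball R. \<forall>i\<in>V. norm (x i k \<omega> - y0) \<le> B"
proof (induction k)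
  case 0
  have "norm (x i 0 \<omega> - y0) \<le> \<bar>R\<bar> + norm y0" if "\<omega> \<in> start_ball R" "i \<in> V" for \<omega> i
    using that norm_triangle_ineq4[of "x i 0 \<omega>" y0] by (fastforce simp: start_ball_def)
  then show ?case by (intro exI[of _ "\<bar>R\<bar> + norm y0"]) auto
next
  case (Suc k)
  then obtain B where B: "B \<ge> 0" "\<And>\<omega> i. \<omega> \<in> start_ball R \<Longrightarrow> i \<in> V \<Longrightarrow> norm (x i k \<omega> - y0) \<le> B"
    by blast
  let ?C = "B + (\<Sum>i\<in>V. norm (prox (\<lambda>y. \<alpha> k * f i y) y0 - y0))"
  have "norm (x i (Suc k) \<omega> - y0) \<le> ?C" if \<omega>: "\<omega> \<in> start_ball R" and i: "i \<in> V" for \<omega> i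
  proof -
    let ?z = "half_step k (iterate k \<omega>) i"
    have \<omega>': "\<omega> \<in> space P" using \<omega> by (simp add: start_ball_def)
    have "(norm (x i (Suc k) \<omega> - y0))\<^sup>2 \<le> (norm (?z - y0))\<^sup>2"
      using closest_point_ineq[of "X i (\<Omega> i k \<omega>)" y0 ?z] chosen_set[OF i \<omega>'] y0(1)
      unfolding algorithm[OF \<omega>' i] by (smt (verit) subset_iff zero_le_power2)
    then have "norm (x i (Suc k) \<omega> - y0) \<le> norm (?z - y0)" by (rule power2_le_imp_le) simp
    also have "\<dots> \<le> ?C" by (rule norm_half_le) (use B \<omega> i in auto)
    finally show ?thesis .
  qed
  moreover have "?C \<ge> 0" using B(1) by (simp add: sum_nonneg)
  ultimately show ?case by blast
qed

lemma half_bounded: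
  "\<exists>B\<ge>0. \<forall>\<omega>\<in>start_ball R. \<forall>i\<in>V. norm (half_step k (iterate k \<omega>) i - y0) \<le> B"
proof -
  obtain B where B: "B \<ge> 0" "\<And>\<omega> i. \<omega> \<in> start_ball R \<Longrightarrow> i \<in> V \<Longrightarrow> norm (x i k \<omega> - y0) \<le> B"
    using iterate_bounded[of R k] by blast
  show ?thesis
  proof (intro exI conjI ballI)
    show "norm (half_step k (iterate k \<omega>) i - y0) \<le> B + (\<Sum>i\<in>V. norm (prox (\<lambda>y. \<alpha> k * f i y) y0 - y0))"
      if "\<omega> \<in> start_ball R" "i \<in> V" for \<omega> i
      by (rule norm_half_le) (use B that in auto)
  qed (use B(1) in \<open>simp add: sum_nonneg\<close>)
qed

lemma integrable_on_start_ball: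
  fixes g :: "'w \<Rightarrow> real"
  assumes "g \<in> borel_measurable P" "\<And>\<omega>. \<omega> \<in> start_ball R \<Longrightarrow> \<bar>g \<omega>\<bar> \<le> B"
  shows "integrable P (\<lambda>\<omega>. indicator (start_ball R) \<omega> * g \<omega>)"
proof (rule integrable_const_bound)
  show "AE \<omega> in P. norm (indicator (start_ball R) \<omega> * g \<omega>) \<le> \<bar>B\<bar>"
    using assms(2) by (intro AE_I2) (fastforce simp: indicator_def)
  show "(\<lambda>\<omega>. indicator (start_ball R) \<omega> * g \<omega>) \<in> borel_measurable P"
    using assms(1) start_ball_sets[OF refl initial] by measurable
qed

section \<open>Expected distances to the constraint sets\<close>

lemma infdist_sq_measurable:
  assumes "u \<in> borel_measurable N"
  shows "(\<lambda>\<omega>. (infdist (u \<omega> :: 'a) S)\<^sup>2) \<in> borel_measurable N"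
proof -
  have "(\<lambda>y. infdist y S) \<in> borel_measurable borel"
    by (intro borel_measurable_continuous_onI continuous_intros)
  from measurable_compose[OF assms this] show ?thesis by measurable
qed

lemma infdist_half_bounded:
  assumes S: "y0 \<in> S" and B: "\<And>\<omega> i. \<omega> \<in> start_ball R \<Longrightarrow> i \<in> V \<Longrightarrow> norm (half_step k (iterate k \<omega>) i - y0) \<le> B"
    and "\<omega> \<in> start_ball R" "i \<in> V"
  shows "\<bar>(infdist (half_step k (iterate k \<omega>) i) S)\<^sup>2\<bar> \<le> B\<^sup>2"
proof -
  have "infdist (half_step k (iterate k \<omega>) i) S \<le> norm (half_step k (iterate k \<omega>) i - y0)"
    using infdist_le[OF S] by (simp add: dist_norm)
  also have "\<dots> \<le> B" using B assms by blast
  finally show ?thesis by (simp add: infdist_nonneg power_mono)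
qed

text \<open>The only place where independence and condition (4) enter.\<close>

lemma expected_infdist_chosen_ge:
  assumes i: "i \<in> V"
  shows "integrable P (\<lambda>\<omega>. indicator (start_ball R) \<omega> * (infdist (half_step k (iterate k \<omega>) i) (X i (\<Omega> i k \<omega>)))\<^sup>2)"
    and "expectation (\<lambda>\<omega>. indicator (start_ball R) \<omega> * (infdist (half_step k (iterate k \<omega>) i) Y)\<^sup>2)
      \<le> c * expectation (\<lambda>\<omega>. indicator (start_ball R) \<omega> * (infdist (half_step k (iterate k \<omega>) i) (X i (\<Omega> i k \<omega>)))\<^sup>2)"
proof -
  let ?A = "start_ball R" and ?z = "\<lambda>\<omega>. half_step k (iterate k \<omega>) i"
  define g where "g j \<omega> = indicator ?A \<omega> * (infdist (?z \<omega>) (X i j))\<^sup>2" for j \<omega>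
  define p where "p j = prob {\<omega>\<in>space P. \<Omega> i k \<omega> = j}" for j
  let ?N = "\<lambda>(i, k :: nat). count_space (I i)" and ?Z = "\<lambda>(i, k). \<Omega> i k"
  \<comment> \<open>The sigma-algebra of the initial points and the choices before time
    \<open>k\<close>; the half step and the event \<open>?A\<close> are measurable with respect to
    it.\<close>
  define F where "F = sigma (space P) (past_generator P (V \<times> {..<k}) ?N ?Z V (\<lambda>_. borel) (\<lambda>i. x i 0))"
  have meas_past: "\<And>q. q \<in> V \<times> {..<k} \<Longrightarrow> ?Z q \<in> measurable P (?N q)"
    using \<Omega>_measurable by auto
  have F_space: "space F = space P"
    unfolding F_def using past_generator_subset_Pow by (intro space_measure_of)
  have F_initial: "x l 0 \<in> borel_measurable F" if "l \<in> V" for l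
    unfolding F_def
    by (rule initial_measurable[where Y = "\<lambda>i. x i 0" and N' = "\<lambda>_. borel", OF meas_past initial that])
  have F_past: "\<Omega> l q \<in> measurable F (count_space (I l))" if "l \<in> V" "q < k" for l q
    using past_measurable[where Z = ?Z and N = ?N and K = "V \<times> {..<k}" and i = "(l, q)" and Y = "\<lambda>i. x i 0" and N' = "\<lambda>_. borel", OF meas_past initial] that
    unfolding F_def by simp
  have zF: "?z \<in> borel_measurable F"
    by (intro half_measurable iterate_measurable[OF F_space F_initial F_past] i) auto
  have AF: "?A \<in> sets F"
    by (rule start_ball_sets[OF F_space F_initial])
  have gF: "g j \<in> borel_measurable F" for j
    unfolding g_def using infdist_sq_measurable[OF zF, of "X i j"] AF by measurable
  obtain B where B: "\<And>\<omega> i. \<omega> \<in> ?A \<Longrightarrow> i \<in> V \<Longrightarrow> norm (half_step k (iterate k \<omega>) i - y0) \<le> B"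
    using half_bounded[of R k] by blast
  have zP: "?z \<in> borel_measurable P"
    by (intro half_measurable iterate_borel i)
  have y0X: "y0 \<in> X i j" if "j \<in> I i" for j using X[OF i that] y0(1) by blast
  have g_int: "integrable P (g j)" if "j \<in> I i" for j
    unfolding g_def
    by (rule integrable_on_start_ball[OF infdist_sq_measurable[OF zP] infdist_half_bounded[OF y0X[OF that] B _ i]])
  \<comment> \<open>For a frozen index \<open>j\<close> the distance to \<open>X i j\<close> is
    determined by the past, whereas \<open>(i, k)\<close> lies outside
    \<open>V \<times> {..<k}\<close>.\<close>
  have ind: "indep_var borel (\<lambda>\<omega>. indicator {j} (\<Omega> i k \<omega>)) borel (g j)" for j
    using indep_var_past[OF indep initial indep_initial, of "(i, k)" "V \<times> {..<k}" "g j" borel "indicator {j}"]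
      gF[of j] i unfolding F_def by auto
  note choice = expectation_finite_choice[OF I[OF i] \<Omega>_measurable[OF i] g_int ind]
  show int: "integrable P (\<lambda>\<omega>. indicator ?A \<omega> * (infdist (?z \<omega>) (X i (\<Omega> i k \<omega>)))\<^sup>2)"
    using choice(1) unfolding g_def .
  \<comment> \<open>Condition (4) concerns deterministic points, so it is used for each
    \<open>\<omega>\<close> at the point \<open>?z \<omega>\<close>, with its expectation written
    out as a sum over the values of the choice.\<close>
  have "indicator ?A \<omega> * (infdist (?z \<omega>) Y)\<^sup>2 \<le> c * (\<Sum>j\<in>I i. p j * g j \<omega>)" for \<omega>
  proof -
    have "(infdist (?z \<omega>) Y)\<^sup>2 \<le> c * (\<Sum>j\<in>I i. p j * (infdist (?z \<omega>) (X i j))\<^sup>2)"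
      using regularity[OF i, of "?z \<omega>" k]
        expectation_finite_valued[OF I[OF i] \<Omega>_measurable[OF i], of "\<lambda>j. (infdist (?z \<omega>) (X i j))\<^sup>2" k]
      by (simp add: p_def)
    then show ?thesis by (simp add: g_def indicator_def)
  qed
  then have "expectation (\<lambda>\<omega>. indicator ?A \<omega> * (infdist (?z \<omega>) Y)\<^sup>2)
      \<le> expectation (\<lambda>\<omega>. c * (\<Sum>j\<in>I i. p j * g j \<omega>))"
    using g_int
    by (intro integral_mono integrable_on_start_ball[OF infdist_sq_measurable[OF zP] infdist_half_bounded[OF y0(1) B _ i]])
       auto
  also have "\<dots> = c * (\<Sum>j\<in>I i. p j * expectation (g j))"
    using g_int by simp
  also have "\<dots> = c * expectation (\<lambda>\<omega>. g (\<Omega> i k \<omega>) \<omega>)"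
    using choice(2) by (simp add: p_def)
  finally show "expectation (\<lambda>\<omega>. indicator ?A \<omega> * (infdist (?z \<omega>) Y)\<^sup>2)
      \<le> c * expectation (\<lambda>\<omega>. indicator ?A \<omega> * (infdist (?z \<omega>) (X i (\<Omega> i k \<omega>)))\<^sup>2)"
    unfolding g_def .
qed

text \<open>At the optimal \<open>y0\<close> the objective term is nonnegative, so it is dropped
  together with the gap.\<close>

lemma iterate_step:
  assumes "\<omega> \<in> space P"
  shows "(\<Sum>i\<in>V. (norm (x i (Suc k) \<omega> - y0))\<^sup>2)
      + (\<Sum>i\<in>V. (infdist (half_step k (iterate k \<omega>) i) (X i (\<Omega> i k \<omega>)))\<^sup>2)
    \<le> (\<Sum>i\<in>V. (norm (x i k \<omega> - y0))\<^sup>2) + infeasibility k (iterate k \<omega>) / (2 * c) + K * (\<alpha> k)\<^sup>2"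
proof -
  have "total y0 \<le> total (closest_point Y (x i0 k \<omega>))"
    using y0 closed_Y by (intro y0(2) closest_point_in_set) auto
  then have "2 * \<alpha> k * (total (closest_point Y (x i0 k \<omega>)) - total y0) \<ge> 0"
    using \<alpha>(1)[of k] by simp
  then show ?thesis
    using descent_step[OF y0(1), of "\<lambda>i. X i (\<Omega> i k \<omega>)" "\<lambda>i. x i (Suc k) \<omega>" k "iterate k \<omega>"]
      chosen_set algorithm assms gap_nonneg[of k "iterate k \<omega>"] by simp
qed

lemma
  shows infeasibility_integrable:
      "integrable P (\<lambda>\<omega>. indicator (start_ball R) \<omega> * infeasibility k (iterate k \<omega>))"
    and summable_expected_infeasibility:
      "summable (\<lambda>k. expectation (\<lambda>\<omega>. indicator (start_ball R) \<omega> * infeasibility k (iterate k \<omega>)))"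
proof -
  let ?A = "start_ball R"
  let ?ind = "\<lambda>\<omega>. indicator ?A \<omega> :: real"
  define D where "D k \<omega> = ?ind \<omega> * (\<Sum>i\<in>V. (norm (x i k \<omega> - y0))\<^sup>2)" for k \<omega>
  define d where "d k \<omega> = ?ind \<omega> * infeasibility k (iterate k \<omega>)" for k \<omega>
  define e where "e k \<omega> = (\<Sum>i\<in>V. ?ind \<omega> * (infdist (half_step k (iterate k \<omega>) i) (X i (\<Omega> i k \<omega>)))\<^sup>2)" for k \<omega>
  have D_int: "integrable P (D k)" for k
  proof -
    obtain B where B: "\<And>\<omega> i. \<omega> \<in> ?A \<Longrightarrow> i \<in> V \<Longrightarrow> norm (x i k \<omega> - y0) \<le> B"
      using iterate_bounded[of R k] by blast
    show ?thesis
      unfolding D_def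
    proof (rule integrable_on_start_ball)
      have "(\<lambda>\<omega>. (norm (x i k \<omega> - y0))\<^sup>2) \<in> borel_measurable P" if "i \<in> V" for i
        using iterate_borel[OF that, of k] by measurable
      then show "(\<lambda>\<omega>. \<Sum>i\<in>V. (norm (x i k \<omega> - y0))\<^sup>2) \<in> borel_measurable P"
        by (rule borel_measurable_sum)
      show "\<bar>\<Sum>i\<in>V. (norm (x i k \<omega> - y0))\<^sup>2\<bar> \<le> (\<Sum>i\<in>V. B\<^sup>2)" if "\<omega> \<in> ?A" for \<omega>
        by (subst abs_of_nonneg) (use B[OF that] in \<open>blast intro: sum_nonneg sum_mono power_mono norm_ge_zero zero_le_power2\<close>)+
    qed
  qed
  have d_eq: "d k = (\<lambda>\<omega>. \<Sum>i\<in>V. ?ind \<omega> * (infdist (half_step k (iterate k \<omega>) i) Y)\<^sup>2)" for k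
    by (auto simp: d_def infeasibility_def sum_distrib_left)
  have d_int_i: "integrable P (\<lambda>\<omega>. ?ind \<omega> * (infdist (half_step k (iterate k \<omega>) i) Y)\<^sup>2)" if i: "i \<in> V" for k i
  proof -
    obtain B where B: "\<And>\<omega> i. \<omega> \<in> ?A \<Longrightarrow> i \<in> V \<Longrightarrow> norm (half_step k (iterate k \<omega>) i - y0) \<le> B"
      using half_bounded[of R k] by blast
    have "(\<lambda>\<omega>. half_step k (iterate k \<omega>) i) \<in> borel_measurable P"
      by (intro half_measurable iterate_borel i)
    from integrable_on_start_ball[OF infdist_sq_measurable[OF this] infdist_half_bounded[OF y0(1) B _ i]]
    show ?thesis .
  qed
  have d_int: "integrable P (d k)" for k
    unfolding d_eq using d_int_i by simp
  then show "integrable P (\<lambda>\<omega>. ?ind \<omega> * infeasibility k (iterate k \<omega>))"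
    unfolding d_def .
  have e_int: "integrable P (e k)" for k
    unfolding e_def using expected_infdist_chosen_ge(1) by simp
  have d_le_e: "expectation (d k) \<le> c * expectation (e k)" for k
  proof -
    have "expectation (d k) = (\<Sum>i\<in>V. expectation (\<lambda>\<omega>. ?ind \<omega> * (infdist (half_step k (iterate k \<omega>) i) Y)\<^sup>2))"
      unfolding d_eq using d_int_i by simp
    also have "\<dots> \<le> (\<Sum>i\<in>V. c * expectation (\<lambda>\<omega>. ?ind \<omega> * (infdist (half_step k (iterate k \<omega>) i) (X i (\<Omega> i k \<omega>)))\<^sup>2))"
      by (intro sum_mono expected_infdist_chosen_ge(2))
    also have "\<dots> = c * expectation (e k)"
      unfolding e_def using expected_infdist_chosen_ge(1) by (simp add: sum_distrib_left)
    finally show ?thesis .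
  qed
  \<comment> \<open>The gain \<open>e\<close> is in expectation at least \<open>d / c\<close>, that
    is, twice \<open>d / (2 * c)\<close>: one half cancels the error term and the other remains as a
    summable gain. This explains the weight \<open>1 / (2 * c)\<close> in Young's
    inequality.\<close>
  have step: "expectation (D (Suc k)) + expectation (d k) / (2 * c) \<le> expectation (D k) + K * (\<alpha> k)\<^sup>2" for k
  proof -
    have "D (Suc k) \<omega> + e k \<omega> \<le> D k \<omega> + d k \<omega> / (2 * c) + K * (\<alpha> k)\<^sup>2" if "\<omega> \<in> space P" for \<omega>
      using iterate_step[OF that, of k] K_nonneg
      by (simp add: D_def d_def e_def indicator_def)
    then have "expectation (\<lambda>\<omega>. D (Suc k) \<omega> + e k \<omega>) \<le> expectation (\<lambda>\<omega>. D k \<omega> + d k \<omega> / (2 * c) + K * (\<alpha> k)\<^sup>2)"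
      using D_int d_int e_int by (intro integral_mono) auto
    then have "expectation (D (Suc k)) + expectation (e k) \<le> expectation (D k) + expectation (d k) / (2 * c) + K * (\<alpha> k)\<^sup>2"
      using D_int d_int e_int by (simp add: prob_space)
    moreover have "expectation (d k) / c \<le> expectation (e k)"
      using d_le_e[of k] c by (simp add: pos_divide_le_eq mult.commute)
    moreover have "expectation (d k) / c = expectation (d k) / (2 * c) + expectation (d k) / (2 * c)"
      using c by simp
    ultimately show ?thesis by linarith
  qed
  have D0: "expectation (D k) \<ge> 0" and d0: "expectation (d k) / (2 * c) \<ge> 0" for k
    using c infeasibility_nonneg
    by (auto simp: D_def d_def intro!: Bochner_Integration.integral_nonneg divide_nonneg_pos mult_nonneg_nonneg sum_nonneg)
  have "summable (\<lambda>k. expectation (d k) / (2 * c))"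
    by (rule quasi_Fejer_monotone(2)[where a = "\<lambda>k. expectation (D k)" and \<beta> = "\<lambda>k. K * (\<alpha> k)\<^sup>2"])
       (use step D0 d0 K_nonneg \<alpha>(3) in auto)
  from summable_mult[OF this, of "2 * c"]
  show "summable (\<lambda>k. expectation (\<lambda>\<omega>. ?ind \<omega> * infeasibility k (iterate k \<omega>)))"
    using c by (simp add: d_def[abs_def])
qed

text \<open>Every sample point lies in \<open>start_ball R\<close> for some natural number
  \<open>R\<close>, and countably many null sets may be discarded.\<close>

lemma AE_summable_infeasibility:
  "AE \<omega> in P. summable (\<lambda>k. infeasibility k (iterate k \<omega>))"
proof -
  have "AE \<omega> in P. \<forall>R::nat. summable (\<lambda>k. indicator (start_ball R) \<omega> * infeasibility k (iterate k \<omega>))"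
    unfolding AE_all_countable
    by (intro allI AE_summable infeasibility_integrable summable_expected_infeasibility)
       (simp add: infeasibility_nonneg)
  with AE_space show ?thesis
  proof eventually_elim
    case (elim \<omega>)
    obtain R :: nat where R: "(\<Sum>i\<in>V. norm (x i 0 \<omega>)) \<le> R"
      using real_arch_simple by blast
    have "norm (x i 0 \<omega>) \<le> R" if "i \<in> V" for i
      using member_le_sum[of i V "\<lambda>i. norm (x i 0 \<omega>)"] that V(1) R by simp
    then have "\<omega> \<in> start_ball R" using elim(1) by (simp add: start_ball_def)
    then show ?case using elim(2)[rule_format, of R] by simp
  qed
qed

section \<open>Almost sure convergence and measurability of the limit\<close>

lemma AE_convergence:
  "AE \<omega> in P. \<exists>y\<in>Y. total y = total y0 \<and> (\<forall>i\<in>V. (\<lambda>k. x i k \<omega>) \<longlonglongrightarrow> y)"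
  using AE_summable_infeasibility AE_space
proof eventually_elim
  case (elim \<omega>)
  show ?case
    by (rule run_convergence[OF y0, where S = "\<lambda>i k. X i (\<Omega> i k \<omega>)"])
       (use elim chosen_set algorithm in auto)
qed

lemma random_limit:
  "\<exists>xstar. xstar \<in> borel_measurable P
      \<and> (\<forall>\<omega>\<in>space P. xstar \<omega> \<in> Y \<and> total (xstar \<omega>) = total y0)
      \<and> (\<forall>i\<in>V. AE \<omega> in P. (\<lambda>k. x i k \<omega>) \<longlonglongrightarrow> xstar \<omega>)"
proof -
  define Z where "Z = {y\<in>Y. total y = total y0}"
  have "continuous_on UNIV total"
    by (intro continuous_on_sum convex_on_continuous open_UNIV convex)
  then have "closed Z"
    unfolding Z_def using closed_Y
    by (intro closed_Collect_conj[of "\<lambda>y. y \<in> Y", simplified] closed_Collect_eq continuous_on_const) auto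
  define l where "l \<omega> = lim (\<lambda>k. x i0 k \<omega>)" for \<omega>
  \<comment> \<open>The limit of agent \<open>i0\<close> is measurable, and replacing it by
    \<open>y0\<close> outside the closed set \<open>Z\<close> makes the random point optimal at
    every sample point, including those where the iterates diverge.\<close>
  define xstar where "xstar \<omega> = (if l \<omega> \<in> Z then l \<omega> else y0)" for \<omega>
  have l: "l \<in> borel_measurable P"
    unfolding l_def using iterate_borel[OF V(2)] by (rule borel_measurable_lim_metric)
  have "Measurable.pred P (\<lambda>\<omega>. l \<omega> \<in> Z)"
    by (rule pred_sets2[OF borel_closed[OF \<open>closed Z\<close>] l])
  then have "xstar \<in> borel_measurable P"
    unfolding xstar_def using l by (intro measurable_If) (auto simp: pred_def)
  moreover have "xstar \<omega> \<in> Y \<and> total (xstar \<omega>) = total y0" for \<omega>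
    using y0(1) by (simp add: xstar_def Z_def)
  moreover have "AE \<omega> in P. (\<lambda>k. x i k \<omega>) \<longlonglongrightarrow> xstar \<omega>" if i: "i \<in> V" for i
    using AE_convergence
  proof eventually_elim
    case (elim \<omega>)
    then obtain y where y: "y \<in> Z" "\<And>i. i \<in> V \<Longrightarrow> (\<lambda>k. x i k \<omega>) \<longlonglongrightarrow> y"
      unfolding Z_def by blast
    have "l \<omega> = y" unfolding l_def using y(2)[OF V(2)] by (rule limI)
    then show ?case using y i by (simp add: xstar_def)
  qed
  ultimately show ?thesis by blast
qed

end

section \<open>Translation of the hypotheses and conclusion of the theorem\<close>

lemma mem_minimizers_iff:
  "y \<in> minimizers F S \<longleftrightarrow> y \<in> S \<and> (\<forall>p\<in>S. F y \<le> F p)"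
proof
  assume "y \<in> minimizers F S"
  then have y: "y \<in> S" "ereal (F y) = (INF p\<in>S. ereal (F p))" by (auto simp: minimizers_def)
  have "F y \<le> F p" if "p \<in> S" for p
    using INF_lower[OF that, of "\<lambda>p. ereal (F p)"] unfolding y(2)[symmetric] by simp
  with y(1) show "y \<in> S \<and> (\<forall>p\<in>S. F y \<le> F p)" by blast
next
  assume y: "y \<in> S \<and> (\<forall>p\<in>S. F y \<le> F p)"
  then have "ereal (F y) = (INF p\<in>S. ereal (F p))"
    by (intro antisym INF_greatest INF_lower) auto
  with y show "y \<in> minimizers F S" by (simp add: minimizers_def)
qed

lemma strongly_connected_rtrancl:
  assumes "strongly_connected \<lparr>verts = V, arcs = A, tail = fst, head = snd\<rparr>"
    and "A \<subseteq> R" "a \<in> V" "b \<in> V"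
  shows "(a, b) \<in> R\<^sup>*"
proof -
  let ?G = "\<lparr>verts = V, arcs = A, tail = fst, head = snd\<rparr>"
  have "arcs_ends ?G = A" by (simp add: arcs_ends_def arc_to_ends_def)
  moreover have "(a, b) \<in> rtrancl_on V (arcs_ends ?G)"
    using assms by (auto simp: strongly_connected_def reachable_def)
  ultimately have "(a, b) \<in> A\<^sup>*" using rtrancl_on_rtranclI by metis
  then show ?thesis using rtrancl_mono[OF assms(2)] by blast
qed

lemma not_summable_of_suminf_top:
  fixes a :: "nat \<Rightarrow> real"
  assumes "(\<Sum>k. ereal (a k)) = \<infinity>" "\<And>k. a k \<ge> 0"
  shows "\<not> summable a"
proof
  assume "summable a"
  then have "(\<lambda>k. ereal (a k)) sums ereal (suminf a)" by (simp add: sums_ereal summable_sums)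
  then show False using assms(1) by (simp add: sums_iff)
qed

theorem theorem3p1:
  fixes m n :: nat
    and V :: "nat set"
    and I :: "nat \<Rightarrow> nat set"
    and X :: "nat \<Rightarrow> nat \<Rightarrow> (real ^ 'd) set"
    and f :: "nat \<Rightarrow> real ^ 'd \<Rightarrow> real"
    and E :: "nat \<Rightarrow> (nat \<times> nat) set"
    and W :: "nat \<Rightarrow> nat \<Rightarrow> nat \<Rightarrow> real"
    and \<alpha> :: "nat \<Rightarrow> real"
    and P :: "'w measure"
    and \<Omega> :: "nat \<Rightarrow> nat \<Rightarrow> 'w \<Rightarrow> nat"
    and x :: "nat \<Rightarrow> nat \<Rightarrow> 'w \<Rightarrow> real ^ 'd"
  assumes users: "V = {1..m}"
    and index_sets: "(\<Union>i\<in>V. I i) = {1..n}" "disjoint_family_on I V" "\<forall>i\<in>V. I i \<noteq> {}"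
    and prob_space: "prob_space P"
    \<comment> \<open>(1)\<close>
    and sets: "\<forall>i\<in>V. \<forall>j\<in>I i. closed (X i j) \<and> convex (X i j)"
    and feasible: "feasible_set V I X \<noteq> {}"
    and convex: "\<forall>i\<in>V. convex_on UNIV (f i)"
    and subgradients: "\<forall>i\<in>V. \<exists>B. \<forall>y\<in>user_set I X i. \<forall>g\<in>subdifferential (f i) y. norm g \<le> B"
    and solvable: "minimizers (objective V f) (feasible_set V I X) \<noteq> {}"
    \<comment> \<open>(2)\<close>
    and edges: "\<forall>k. E k \<subseteq> V \<times> V" "\<forall>k. \<forall>i\<in>V. i \<in> neighbours V E i k"
    and connected: "\<exists>Q\<ge>1. \<forall>k. strongly_connected
          \<lparr>verts = V, arcs = (\<Inter>l\<in>{0..Q - 1}. E (k + l)), tail = fst, head = snd\<rparr>"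
    \<comment> \<open>(3)\<close>
    and initial: "\<forall>i\<in>V. x i 0 \<in> borel_measurable P"
    and indep: "prob_space.indep_vars P (\<lambda>(i, k). count_space (I i)) (\<lambda>(i, k). \<Omega> i k) (V \<times> UNIV)"
    and indep_initial: "prob_space.indep_set P
          (generated_events P (V \<times> UNIV) (\<lambda>(i, k). count_space (I i)) (\<lambda>(i, k). \<Omega> i k))
          (generated_events P V (\<lambda>_. borel) (\<lambda>i. x i 0))"
    and identical: "\<forall>i\<in>V. \<forall>k l. distr P (count_space (I i)) (\<Omega> i k) = distr P (count_space (I i)) (\<Omega> i l)"
    and positive: "\<forall>i\<in>V. \<forall>k. \<forall>j\<in>I i. measure P {\<omega> \<in> space P. \<Omega> i k \<omega> = j} > 0"
    \<comment> \<open>(4)\<close>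
    and regularity: "\<exists>c>0. \<forall>i\<in>V. \<forall>y k. (infdist y (feasible_set V I X))\<^sup>2
          \<le> c * (\<integral>\<omega>. (infdist y (X i (\<Omega> i k \<omega>)))\<^sup>2 \<partial>P)"
    \<comment> \<open>(5)\<close>
    and weights: "\<forall>k. \<forall>i\<in>V. \<forall>j\<in>V. W i j k \<ge> 0"
      "\<forall>k. \<forall>i\<in>V. \<forall>j\<in>V. j \<notin> neighbours V E i k \<longrightarrow> W i j k = 0"
      "\<forall>k. \<forall>i\<in>V. (\<Sum>j\<in>V. W i j k) = 1"
      "\<forall>k. \<forall>j\<in>V. (\<Sum>i\<in>V. W i j k) = 1"
      "\<exists>w. 0 < w \<and> w < 1 \<and> (\<forall>i\<in>V. \<forall>k. \<forall>j\<in>neighbours V E i k. W i j k \<ge> w)"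
    and step_sizes: "\<forall>k. \<alpha> k > 0" "(\<Sum>k. ereal (\<alpha> k)) = \<infinity>" "summable (\<lambda>k. (\<alpha> k)\<^sup>2)"
    \<comment> \<open>the random projected proximal algorithm\<close>
    and algorithm: "\<forall>\<omega>\<in>space P. \<forall>k. \<forall>i\<in>V. x i (Suc k) \<omega> =
          closest_point (X i (\<Omega> i k \<omega>))
            (prox (\<lambda>y. \<alpha> k * f i y) (\<Sum>j\<in>neighbours V E i k. W i j k *\<^sub>R x j k \<omega>))"
  shows "\<exists>xstar. xstar \<in> borel_measurable P
      \<and> (\<forall>\<omega>\<in>space P. xstar \<omega> \<in> minimizers (objective V f) (feasible_set V I X))
      \<and> (\<forall>i\<in>V. AE \<omega> in P. (\<lambda>k. x i k \<omega>) \<longlonglongrightarrow> xstar \<omega>)"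
proof -
  interpret prob_space P by (rule prob_space)
  define Y where "Y = feasible_set V I X"
  obtain Q where Q: "Q \<ge> 1" "\<And>k. strongly_connected
      \<lparr>verts = V, arcs = (\<Inter>l\<in>{0..Q - 1}. E (k + l)), tail = fst, head = snd\<rparr>"
    using connected by blast
  have connected_now: "(a, b) \<in> (E k)\<^sup>*" if "a \<in> V" "b \<in> V" for a b k
  proof (rule strongly_connected_rtrancl[OF Q(2)[of k] _ that])
    show "(\<Inter>l\<in>{0..Q - 1}. E (k + l)) \<subseteq> E k"
      using INT_lower[of 0 "{0..Q - 1}" "\<lambda>l. E (k + l)"] by simp
  qed
  \<comment> \<open>Strong connectivity includes that the vertex set is nonempty, which excludes
    \<open>m = 0\<close>.\<close>
  have V: "finite V" "V \<noteq> {}"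
    using users Q(2)[of 0] by (auto simp: strongly_connected_def)
  then obtain i0 where i0: "i0 \<in> V" by blast
  obtain c where c: "c > 0" "\<And>i y k. i \<in> V \<Longrightarrow>
      (infdist y Y)\<^sup>2 \<le> c * (\<integral>\<omega>. (infdist y (X i (\<Omega> i k \<omega>)))\<^sup>2 \<partial>P)"
    using regularity unfolding Y_def by blast
  obtain w where w: "w > 0" "\<And>i j k. i \<in> V \<Longrightarrow> j \<in> neighbours V E i k \<Longrightarrow> W i j k \<ge> w"
    using weights(5) by blast
  define \<kappa> where "\<kappa> = w / (2 * (real (card V))^4)"
  have card: "card V > 0" using V by (simp add: card_gt_0_iff)
  have "\<exists>B. \<forall>i\<in>V. \<forall>y\<in>user_set I X i. \<forall>g\<in>subdifferential (f i) y. norm g \<le> B i"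
    using bchoice[OF subgradients] by simp
  then obtain B where B: "\<And>i y g. i \<in> V \<Longrightarrow> y \<in> user_set I X i \<Longrightarrow> g \<in> subdifferential (f i) y \<Longrightarrow> norm g \<le> B i"
    by blast
  \<comment> \<open>One bound for all agents, valid on the common feasible set; the absolute values
    let the sum dominate each member.\<close>
  define M where "M = (\<Sum>i\<in>V. \<bar>B i\<bar>)"
  have M: "norm g \<le> M" if "i \<in> V" "y \<in> Y" "g \<in> subdifferential (f i) y" for i y g
  proof -
    have "norm g \<le> \<bar>B i\<bar>" using B[of i y g] that by (force simp: Y_def feasible_set_def)
    also have "\<dots> \<le> M" unfolding M_def using that(1) V(1) by (intro member_le_sum) auto
    finally show ?thesis .
  qed
  have XY: "closed (X i j) \<and> convex (X i j) \<and> Y \<subseteq> X i j" if "i \<in> V" "j \<in> I i" for i j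
    using sets that by (auto simp: Y_def feasible_set_def user_set_def)
  have "closed Y"
    unfolding Y_def feasible_set_def user_set_def using sets by (intro closed_INT) auto
  interpret net: prox_network V i0 f Y W \<alpha> M c \<kappa>
  proof
    show "\<kappa> > 0" using w(1) card by (simp add: \<kappa>_def)
    show "\<not> summable \<alpha>"
      using step_sizes by (intro not_summable_of_suminf_top) (auto intro: less_imp_le)
    show "M \<ge> 0" by (simp add: M_def sum_nonneg)
    fix k and y :: "nat \<Rightarrow> real ^ 'd" and v a b assume ab: "a \<in> V" "b \<in> V"
    have "w * (norm (y a - y b))\<^sup>2
        \<le> 2 * (real (card V))^4 * (\<Sum>i\<in>V. \<Sum>j\<in>V. W i j k * (norm (y j - v i))\<^sup>2)"
    \<comment> \<open>The whole edge set \<open>E k\<close> serves as the relation: all its edges,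
      the self-loops included, carry weight at least \<open>w\<close>.\<close>
    proof (rule strongly_connected_variance[where R = "E k" and W = "\<lambda>i j. W i j k"])
      show "W i j k \<ge> w" if "(i, j) \<in> E k" for i j
        using that edges(1) by (intro w(2)) (auto simp: neighbours_def)
    qed (use V edges connected_now[OF ab] weights w in auto)
    then show "\<kappa> * (norm (y a - y b))\<^sup>2 \<le> (\<Sum>i\<in>V. \<Sum>j\<in>V. W i j k * (norm (y j - v i))\<^sup>2)"
      using card by (simp add: \<kappa>_def pos_divide_le_eq mult.commute)
  qed (use V i0 convex M \<open>closed Y\<close> step_sizes c weights in auto)
  obtain y0 where "y0 \<in> minimizers (objective V f) Y"
    using solvable unfolding Y_def by blast
  then have y0: "y0 \<in> Y" "\<And>p. p \<in> Y \<Longrightarrow> objective V f y0 \<le> objective V f p"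
    by (auto simp: mem_minimizers_iff)
  have "random_prox_network V i0 f Y W \<alpha> M c \<kappa> P I X \<Omega> x y0"
  proof unfold_locales
    show "finite (I i)" if "i \<in> V" for i
      using index_sets(1) that by (intro finite_subset[of "I i" "{1..n}"]) auto
    show "x i (Suc k) \<omega> = closest_point (X i (\<Omega> i k \<omega>)) (net.half_step k (\<lambda>j. x j k \<omega>) i)"
      if "\<omega> \<in> space P" "i \<in> V" for \<omega> k i
    proof -
      \<comment> \<open>The weights vanish outside the neighbourhood, so the algorithm's sum is the
        full average used in \<open>mix\<close>.\<close>
      have "(\<Sum>j\<in>neighbours V E i k. W i j k *\<^sub>R x j k \<omega>) = (\<Sum>j\<in>V. W i j k *\<^sub>R x j k \<omega>)"
        using V(1) weights(2) that by (intro sum.mono_neutral_left) (auto simp: neighbours_def)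
      then show ?thesis
        using algorithm that by (simp add: net.half_step_def net.mix_def)
    qed
  qed (use y0 XY initial indep indep_initial c in \<open>auto simp: objective_def\<close>)
  from random_prox_network.random_limit[OF this] obtain xstar where
    "xstar \<in> borel_measurable P"
    "\<And>\<omega>. \<omega> \<in> space P \<Longrightarrow> xstar \<omega> \<in> Y \<and> objective V f (xstar \<omega>) = objective V f y0"
    "\<And>i. i \<in> V \<Longrightarrow> AE \<omega> in P. (\<lambda>k. x i k \<omega>) \<longlonglongrightarrow> xstar \<omega>"
    by (auto simp: objective_def)
  with y0 show ?thesis
    by (intro exI[of _ xstar]) (simp add: mem_minimizers_iff Y_def)
qed

end
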